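(* Let $G$ be a path-connected topological group and let $p\colon E\to B$ be a principal $G$-bundle. Then for every $r\ge 2$, $$\mathrm{dTC}_r[p\colon E\to B]=\mathrm{dTC}_r(G)=\mathrm{dcat}(G^{r-1}).$$
   Context: Conventions: all spaces are path-connected, fibrations are Hurewicz fibrations, sections are continuous, $I=[0,1]$, path spaces carry the compact-open topology. Spaces to which the distributional invariants below are applied (total spaces of fibrations) are metric spaces. For a metric space $X$ and $k\ge 1$, $\mathcal{B}_k(X)$ is the set of probability measures on $X$ supported on at most $k$ points, with the Lévy–Prokhorov metric topology. For a fibration $p\colon E\to B$ with $E$ metric, let $E_k(p)=\{\mu\in\mathcal{B}_k(E)\mid \mathrm{supp}(\mu)\subset p^{-1}(x)\text{ for some }x\in B\}$ and $\mathcal{B}_k(p)\colon E_k(p)\to B$, $\mathcal{B}_k(p)(\mu)=x$ if $\mathrm{supp}(\mu)\subset p^{-1}(x)$; this is a fibration. The distributional sectional category $\mathrm{dsecat}(p)$ is the smallest integer $n\geq 0$ such that $\mathcal{B}_{n+1}(p)$ admits a section. For a fibration $p\colon E\to B$ and $r\ge2$: $E^I_B=\{\gamma\in E^I\mid p\circ\gamma \text{ is constant}\}$, $E^r_B=\{(e_1,\dots,e_r)\in E^r\mid p(e_i)=p(e_j)\ \forall i,j\}$, and $\Pi_r^E\colon E^I_B\to E^r_B$ is the fibration $\gamma\mapsto(\gamma(0),\gamma(\tfrac1{r-1}),\dots,\gamma(\tfrac{r-2}{r-1}),\gamma(1))$. The $r$-th sequential parametrized distributional complexity is $\mathrm{dTC}_r[p\colon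 E\to B]:=\mathrm{dsecat}(\Pi_r^E)$. For a space $X$: $\mathrm{dTC}_r(X):=\mathrm{dsecat}(\pi_r^X)$, where $\pi_r^X\colon X^I\to X^r$, $\pi_r^X(\phi)=(\phi(0),\phi(\tfrac1{r-1}),\dots,\phi(1))$. For a pointed space $(X,x_0)$, $\mathrm{dcat}(X):=\mathrm{dsecat}(p^X)$, where $P_0(X)=\{\phi\in X^I\mid\phi(1)=x_0\}$ and $p^X\colon P_0(X)\to X$, $p^X(\phi)=\phi(0)$. *)

theory Defs
  imports
    "HOL-Analysis.Analysis"
    "HOL-Probability.Probability_Mass_Function"
    "HOL-Library.Extended_Nat"
    "HOL-Algebra.Group"
begin

section \<open>Finitely supported probability measures and the Levy--Prokhorov metric\<close>

text \<open>
  A probability measure supported on at most \<open>k\<close> points of a metric space is represented by a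
  probability mass function; \<^const>\<open>set_pmf\<close> is its support.
\<close>
definition finite_prob :: "nat \<Rightarrow> 'a metric \<Rightarrow> 'a pmf set" where
  "finite_prob k m =
     {\<mu>. set_pmf \<mu> \<subseteq> mspace m \<and> finite (set_pmf \<mu>) \<and> card (set_pmf \<mu>) \<le> k}"

definition borel_sets_of :: "'a metric \<Rightarrow> 'a set set" where
  "borel_sets_of m = sigma_sets (mspace m) {U. openin (mtopology_of m) U}"

definition metric_thickening :: "'a metric \<Rightarrow> real \<Rightarrow> 'a set \<Rightarrow> 'a set" where
  "metric_thickening m \<epsilon> A = {x \<in> mspace m. \<exists>a\<in>A. mdist m a x < \<epsilon>}"

definition lp_close :: "'a metric \<Rightarrow> real \<Rightarrow> 'a pmf \<Rightarrow> 'a pmf \<Rightarrow> bool" where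
  "lp_close m \<epsilon> \<mu> \<nu> \<longleftrightarrow> 0 < \<epsilon> \<and>
       (\<forall>A \<in> borel_sets_of m.
          measure_pmf.prob \<mu> A \<le> measure_pmf.prob \<nu> (metric_thickening m \<epsilon> A) + \<epsilon> \<and>
          measure_pmf.prob \<nu> A \<le> measure_pmf.prob \<mu> (metric_thickening m \<epsilon> A) + \<epsilon>)"

definition levy_prokhorov_dist :: "'a metric \<Rightarrow> 'a pmf \<Rightarrow> 'a pmf \<Rightarrow> real" where
  "levy_prokhorov_dist m \<mu> \<nu> = Inf {\<epsilon>. lp_close m \<epsilon> \<mu> \<nu>}"

definition finite_prob_metric :: "nat \<Rightarrow> 'a metric \<Rightarrow> 'a pmf metric" where
  "finite_prob_metric k m = metric (finite_prob k m, levy_prokhorov_dist m)"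

lemma lp_close_one: "lp_close m 1 \<mu> \<nu>"
  by (auto simp: lp_close_def intro: order_trans[OF measure_pmf.prob_le_1])

lemma lp_close_sym: "lp_close m \<epsilon> \<mu> \<nu> \<longleftrightarrow> lp_close m \<epsilon> \<nu> \<mu>"
  by (auto simp: lp_close_def)

lemma metric_thickening_mono: "\<epsilon> \<le> \<delta> \<Longrightarrow> metric_thickening m \<epsilon> A \<subseteq> metric_thickening m \<delta> A"
  by (force simp: metric_thickening_def)

lemma lp_close_mono: assumes "lp_close m \<epsilon> \<mu> \<nu>" "\<epsilon> \<le> \<delta>" shows "lp_close m \<delta> \<mu> \<nu>"
proof -
  have *: "measure_pmf.prob \<rho> (metric_thickening m \<epsilon> A) + \<epsilon>
      \<le> measure_pmf.prob \<rho> (metric_thickening m \<delta> A) + \<delta>" for \<rho> A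
    by (intro add_mono measure_pmf.finite_measure_mono metric_thickening_mono assms) auto
  show ?thesis
    using assms unfolding lp_close_def
    by (intro conjI ballI; (force intro: order_trans[OF _ *]))
qed

lemma openin_metric_thickening:
  assumes "A \<subseteq> mspace m"
  shows "openin (mtopology_of m) (metric_thickening m \<epsilon> A)"
proof -
  have "metric_thickening m \<epsilon> A = (\<Union>a\<in>A. mball_of m a \<epsilon>)"
    using assms by (fastforce simp: metric_thickening_def)
  moreover have "openin (mtopology_of m) (mball_of m a \<epsilon>)" for a
    by (simp add: mtopology_of_def mball_of_def
        Metric_space.openin_mball[OF Metric_space_mspace_mdist])
  ultimately show ?thesis
    by (auto intro: openin_Union)
qed

lemma borel_sets_of_subset: "A \<in> borel_sets_of m \<Longrightarrow> A \<subseteq> mspace m"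
  unfolding borel_sets_of_def
  by (erule sigma_sets_into_sp[rotated]) (use openin_subset in fastforce)

lemma borel_sets_of_thickening:
  "A \<in> borel_sets_of m \<Longrightarrow> metric_thickening m \<epsilon> A \<in> borel_sets_of m"
  using openin_metric_thickening[OF borel_sets_of_subset]
  by (force simp: borel_sets_of_def)

lemma borel_sets_of_singleton:
  assumes "x \<in> mspace m" shows "{x} \<in> borel_sets_of m"
proof -
  have "closedin (mtopology_of m) {x}"
    using assms Metric_space.Hausdorff_space_mtopology[OF Metric_space_mspace_mdist, of m]
    by (simp add: closedin_Hausdorff_singleton mtopology_of_def
        Metric_space.topspace_mtopology[OF Metric_space_mspace_mdist])
  then have "mspace m - {x} \<in> borel_sets_of m"
    by (auto simp: closedin_def borel_sets_of_def)
  then have "mspace m - (mspace m - {x}) \<in> borel_sets_of m"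
    unfolding borel_sets_of_def by (rule sigma_sets.Compl)
  then show ?thesis using assms by (simp add: double_diff)
qed

lemma lp_close_trans:
  assumes "lp_close m \<epsilon> \<mu> \<nu>" "lp_close m \<delta> \<nu> \<rho>"
  shows "lp_close m (\<epsilon> + \<delta>) \<mu> \<rho>"
proof -
  have sub: "metric_thickening m b (metric_thickening m a A) \<subseteq> metric_thickening m (a + b) A"
    if A: "A \<in> borel_sets_of m" for a b A
  proof
    fix x assume "x \<in> metric_thickening m b (metric_thickening m a A)"
    then obtain y c where *: "x \<in> mspace m" "y \<in> mspace m" "c \<in> A" "mdist m c y < a" "mdist m y x < b"
      by (auto simp: metric_thickening_def)
    moreover have "c \<in> mspace m" using borel_sets_of_subset[OF A] * by auto
    ultimately have "mdist m c x < a + b"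
      using mdist_triangle[of c m y x] by auto
    with * show "x \<in> metric_thickening m (a + b) A" by (auto simp: metric_thickening_def)
  qed
  have step: "measure_pmf.prob \<mu> A \<le> measure_pmf.prob \<rho> (metric_thickening m (a + b) A) + (a + b)"
    if A: "A \<in> borel_sets_of m" and c: "lp_close m a \<mu> \<nu>" "lp_close m b \<nu> \<rho>" for a b A \<mu> \<nu> \<rho>
  proof -
    have "measure_pmf.prob \<mu> A \<le> measure_pmf.prob \<nu> (metric_thickening m a A) + a"
      using c A by (auto simp: lp_close_def)
    moreover have "measure_pmf.prob \<nu> (metric_thickening m a A)
        \<le> measure_pmf.prob \<rho> (metric_thickening m b (metric_thickening m a A)) + b"
      using c borel_sets_of_thickening[OF A] by (auto simp: lp_close_def)
    moreover have "measure_pmf.prob \<rho> (metric_thickening m b (metric_thickening m a A))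
        \<le> measure_pmf.prob \<rho> (metric_thickening m (a + b) A)"
      by (intro measure_pmf.finite_measure_mono sub A) auto
    ultimately show ?thesis by linarith
  qed
  show ?thesis
    using step[OF _ assms] step[OF _ assms(2)[unfolded lp_close_sym[of _ _ \<nu>]] assms(1)[unfolded lp_close_sym[of _ _ \<mu>]]] assms
    by (auto simp: lp_close_def add.commute)
qed

lemma levy_prokhorov_dist_nonneg: "0 \<le> levy_prokhorov_dist m \<mu> \<nu>"
  unfolding levy_prokhorov_dist_def   by (rule cInf_greatest) (use lp_close_one[of m \<mu> \<nu>] in blast, simp add: lp_close_def)

lemma levy_prokhorov_dist_less_iff: "levy_prokhorov_dist m \<mu> \<nu> < \<epsilon> \<longleftrightarrow> (\<exists>\<delta><\<epsilon>. lp_close m \<delta> \<mu> \<nu>)"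
proof -
  have "{\<epsilon>. lp_close m \<epsilon> \<mu> \<nu>} \<noteq> {}"
    using lp_close_one[of m \<mu> \<nu>] by blast
  moreover have "bdd_below {\<epsilon>. lp_close m \<epsilon> \<mu> \<nu>}"
    by (rule bdd_belowI[of _ 0]) (auto simp: lp_close_def)
  ultimately show ?thesis unfolding levy_prokhorov_dist_def by (subst cInf_less_iff) auto
qed

lemma levy_prokhorov_dist_0_imp_le:
  assumes \<mu>: "\<mu> \<in> finite_prob k m" and \<nu>: "\<nu> \<in> finite_prob k m"
    and 0: "levy_prokhorov_dist m \<mu> \<nu> = 0"
  shows "pmf \<mu> x \<le> pmf \<nu> x"
proof (cases "x \<in> mspace m")
  case False
  then show ?thesis using \<mu> set_pmf_iff[of x \<mu>] by (auto simp: finite_prob_def)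
next
  case True
  define D where "D = mdist m x ` (set_pmf \<nu> - {x})"
  have fin: "finite D" using \<nu> by (auto simp: D_def finite_prob_def)
  have pos: "0 < d" if "d \<in> D" for d
    using that True \<nu> mdist_nonneg[of m x] mdist_zero[of x m]
    by (force simp: D_def finite_prob_def less_le)
  define d where "d = Min (insert 1 D)"
  have d: "0 < d" "\<And>y. y \<in> set_pmf \<nu> - {x} \<Longrightarrow> d \<le> mdist m x y"
    using fin pos by (auto simp: d_def D_def)
  show ?thesis
  proof (rule field_le_epsilon)
    fix e :: real assume "0 < e"
    then have "levy_prokhorov_dist m \<mu> \<nu> < min d e" using 0 d by auto
    then obtain \<delta> where \<delta>: "\<delta> < min d e" "lp_close m \<delta> \<mu> \<nu>"
      unfolding levy_prokhorov_dist_less_iff by blast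
    have "metric_thickening m \<delta> {x} \<inter> set_pmf \<nu> \<subseteq> {x}"
      using d(2) \<delta>(1) by (force simp: metric_thickening_def)
    then have "measure_pmf.prob \<nu> (metric_thickening m \<delta> {x}) \<le> measure_pmf.prob \<nu> {x}"
      by (subst measure_Int_set_pmf[symmetric]) (intro measure_pmf.finite_measure_mono; simp)
    moreover have "measure_pmf.prob \<mu> {x} \<le> measure_pmf.prob \<nu> (metric_thickening m \<delta> {x}) + \<delta>"
      using \<delta>(2) borel_sets_of_singleton[OF True] by (auto simp: lp_close_def)
    ultimately show "pmf \<mu> x \<le> pmf \<nu> x + e" using \<delta>(1) by (simp add: measure_pmf_single)
  qed
qed

lemma Metric_space_finite_prob: "Metric_space (finite_prob k m) (levy_prokhorov_dist m)"
proof
  show "0 \<le> levy_prokhorov_dist m \<mu> \<nu>" for \<mu> \<nu> :: "'a pmf"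
    by (rule levy_prokhorov_dist_nonneg)
  show sym: "levy_prokhorov_dist m \<mu> \<nu> = levy_prokhorov_dist m \<nu> \<mu>" for \<mu> \<nu> :: "'a pmf"
    unfolding levy_prokhorov_dist_def by (subst lp_close_sym) simp
  show "(levy_prokhorov_dist m \<mu> \<nu> = 0) = (\<mu> = \<nu>)"
    if "\<mu> \<in> finite_prob k m" "\<nu> \<in> finite_prob k m" for \<mu> \<nu>
  proof
    assume "levy_prokhorov_dist m \<mu> \<nu> = 0"
    then show "\<mu> = \<nu>"
      using levy_prokhorov_dist_0_imp_le[OF that] levy_prokhorov_dist_0_imp_le[OF that(2,1)] sym
      by (intro pmf_eqI) (metis antisym)
  next
    assume "\<mu> = \<nu>"
    have "lp_close m e \<nu> \<nu>" if "0 < e" for e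
    proof -
      have "measure_pmf.prob \<nu> A \<le> measure_pmf.prob \<nu> (metric_thickening m e A) + e"
        if A: "A \<in> borel_sets_of m" for A
      proof -
        have "A \<subseteq> metric_thickening m e A"
          using borel_sets_of_subset[OF A] \<open>0 < e\<close>
          by (auto simp: metric_thickening_def subset_iff mdist_zero[THEN iffD2] intro!: bexI)
        then have "measure_pmf.prob \<nu> A \<le> measure_pmf.prob \<nu> (metric_thickening m e A)"
          by (intro measure_pmf.finite_measure_mono) auto
        then show ?thesis using \<open>0 < e\<close> by linarith
      qed
      then show ?thesis using \<open>0 < e\<close> by (auto simp: lp_close_def)
    qed
    then have "levy_prokhorov_dist m \<nu> \<nu> < e" if "0 < e" for e
      using that by (auto simp: levy_prokhorov_dist_less_iff intro!: exI[of _ "e/2"])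
    then show "levy_prokhorov_dist m \<mu> \<nu> = 0"
      using levy_prokhorov_dist_nonneg[of m \<nu> \<nu>] \<open>\<mu> = \<nu>\<close> by (metis less_irrefl less_le)
  qed
  show "levy_prokhorov_dist m \<mu> \<rho> \<le> levy_prokhorov_dist m \<mu> \<nu> + levy_prokhorov_dist m \<nu> \<rho>"
    for \<mu> \<nu> \<rho> :: "'a pmf"
  proof (rule field_le_epsilon)
    fix e :: real assume "0 < e"
    obtain a where a: "a < levy_prokhorov_dist m \<mu> \<nu> + e/2" "lp_close m a \<mu> \<nu>"
      using \<open>0 < e\<close> levy_prokhorov_dist_less_iff[of m \<mu> \<nu> "levy_prokhorov_dist m \<mu> \<nu> + e/2"] by auto
    obtain b where b: "b < levy_prokhorov_dist m \<nu> \<rho> + e/2" "lp_close m b \<nu> \<rho>"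
      using \<open>0 < e\<close> levy_prokhorov_dist_less_iff[of m \<nu> \<rho> "levy_prokhorov_dist m \<nu> \<rho> + e/2"] by auto
    have "levy_prokhorov_dist m \<mu> \<rho> < levy_prokhorov_dist m \<mu> \<nu> + levy_prokhorov_dist m \<nu> \<rho> + e"
      using lp_close_trans[OF a(2) b(2)] a(1) b(1)
      by (auto simp: levy_prokhorov_dist_less_iff intro!: exI[of _ "a+b"])
    then show "levy_prokhorov_dist m \<mu> \<rho>
        \<le> levy_prokhorov_dist m \<mu> \<nu> + levy_prokhorov_dist m \<nu> \<rho> + e" by simp
  qed
qed

lemma mspace_finite_prob_metric [simp]: "mspace (finite_prob_metric k m) = finite_prob k m"
  by (simp add: finite_prob_metric_def Metric_space.mspace_metric[OF Metric_space_finite_prob])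

lemma mdist_finite_prob_metric [simp]: "mdist (finite_prob_metric k m) = levy_prokhorov_dist m"
  by (simp add: finite_prob_metric_def Metric_space.mdist_metric[OF Metric_space_finite_prob])


section \<open>Distributional sectional category\<close>

definition fibrewise_prob ::
  "nat \<Rightarrow> 'e metric \<Rightarrow> ('e \<Rightarrow> 'b) \<Rightarrow> 'b topology \<Rightarrow> 'e pmf set" where
  "fibrewise_prob k m p B =
     {\<mu> \<in> finite_prob k m. \<exists>x \<in> topspace B. set_pmf \<mu> \<subseteq> {e \<in> mspace m. p e = x}}"

definition fibrewise_prob_map :: "('e \<Rightarrow> 'b) \<Rightarrow> 'e pmf \<Rightarrow> 'b" where
  "fibrewise_prob_map p \<mu> = (THE x. set_pmf \<mu> \<subseteq> {e. p e = x})"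

lemma fibrewise_prob_map_eqI: "set_pmf \<mu> \<subseteq> {e. p e = x} \<Longrightarrow> fibrewise_prob_map p \<mu> = x"
  unfolding fibrewise_prob_map_def
  by (rule the_equality) (use set_pmf_not_empty[of \<mu>] in auto)

text \<open>The value is \<open>\<infinity>\<close> if there is no section for any \<open>n\<close>.\<close>
definition dsecat :: "'e metric \<Rightarrow> ('e \<Rightarrow> 'b) \<Rightarrow> 'b topology \<Rightarrow> enat" where
  "dsecat m p B =
     (INF n \<in> {n. \<exists>s.
          continuous_map B
            (subtopology (mtopology_of (finite_prob_metric (n + 1) m)) (fibrewise_prob (n + 1) m p B)) s \<and>
          (\<forall>b \<in> topspace B. fibrewise_prob_map p (s b) = b)}. enat n)"


section \<open>Path spaces and powers\<close>

text \<open>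
  The path space carries the supremum metric, the finite power the maximum metric.  The two
  lemmas below show that these induce the compact-open and the product topology, respectively.
\<close>
definition path_metric :: "'a metric \<Rightarrow> (real \<Rightarrow> 'a) metric" where
  "path_metric m = cfunspace (top_of_set {0..1}) m"

definition power_metric :: "nat \<Rightarrow> 'a metric \<Rightarrow> (nat \<Rightarrow> 'a) metric" where
  "power_metric k m = funspace {..<k} m"

definition compact_open_topology :: "'a topology \<Rightarrow> 'b topology \<Rightarrow> ('a \<Rightarrow> 'b) topology" where
  "compact_open_topology X Y = topology_generated_by
     {{f \<in> extensional (topspace X). continuous_map X Y f \<and> f ` K \<subseteq> U} | K U.
        compactin X K \<and> openin Y U}"

lemma mspace_path_metric:
  "mspace (path_metric m) =
     {f \<in> extensional {0..1}. continuous_map (top_of_set {0..1}) (mtopology_of m) f}"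
proof -
  have "compactin (top_of_set {0..1::real}) (topspace (top_of_set {0..1}))"
    by (simp add: compactin_subtopology)
  from compactin_mspace_cfunspace[OF this, of m] show ?thesis
    by (auto simp: path_metric_def continuous_map_def)
qed

lemma mspace_power_metric: "mspace (power_metric k m) = ({..<k} \<rightarrow>\<^sub>E mspace m)"
proof -
  have "Metric_space.mbounded (mspace m) (mdist m) S" if "finite S" "S \<subseteq> mspace m" for S
    using that(1,2)
    by (induction S rule: finite_induct)
       (auto simp: Metric_space.mbounded_insert[OF Metric_space_mspace_mdist]
          Metric_space.mbounded_empty[OF Metric_space_mspace_mdist])
  then show ?thesis
    by (auto simp: power_metric_def Metric_space.fspace_def[OF Metric_space_mspace_mdist]
        PiE_def Pi_def image_subset_iff)
qed

lemma mdist_path_metric_le: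
  assumes "f \<in> mspace (path_metric m)" "g \<in> mspace (path_metric m)"
  shows "mdist (path_metric m) f g \<le> a \<longleftrightarrow> (\<forall>t\<in>{0..1}. mdist m (f t) (g t) \<le> a)"
  using cfunspace_mdist_le[of f "top_of_set {0..1}" m g a] assms unfolding path_metric_def by simp

lemma mdist_power_metric_le:
  assumes "f \<in> mspace (power_metric k m)" "g \<in> mspace (power_metric k m)" "0 < k"
  shows "mdist (power_metric k m) f g \<le> a \<longleftrightarrow> (\<forall>i<k. mdist m (f i) (g i) \<le> a)"
proof -
  have "{..<k} \<noteq> {}" using \<open>0 < k\<close> by auto
  from funspace_mdist_le[OF assms(1,2)[unfolded power_metric_def] this] show ?thesis
    unfolding power_metric_def by auto
qed

lemma openin_mtopology_of:
  "openin (mtopology_of m) U \<longleftrightarrow> U \<subseteq> mspace m \<and> (\<forall>x\<in>U. \<exists>r>0. mball_of m x r \<subseteq> U)"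
  by (auto simp: mtopology_of_def mball_of_def
      Metric_space.openin_mtopology[OF Metric_space_mspace_mdist])

lemma openin_mball_of: "openin (mtopology_of m) (mball_of m x r)"
  by (simp add: mtopology_of_def mball_of_def Metric_space.openin_mball[OF Metric_space_mspace_mdist])

lemma mtopology_of_power_metric:
  assumes "0 < k"
  shows "mtopology_of (power_metric k m) = product_topology (\<lambda>_. mtopology_of m) {..<k}"
    (is "?L = ?R")
proof (rule topology_eq[THEN iffD2], intro allI iffI)
  fix W assume W: "openin ?L W"
  show "openin ?R W"
    unfolding openin_product_topology_alt
  proof
    fix x assume "x \<in> W"
    then obtain r where r: "0 < r" "mball_of (power_metric k m) x r \<subseteq> W"
      using W by (auto simp: openin_mtopology_of)
    have x: "x \<in> mspace (power_metric k m)" using W \<open>x \<in> W\<close> by (auto simp: openin_mtopology_of)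
    define U where "U i = mball_of m (x i) (r/2)" for i
    have "Pi\<^sub>E {..<k} U \<subseteq> W"
    proof
      fix y assume y: "y \<in> Pi\<^sub>E {..<k} U"
      then have y': "y \<in> mspace (power_metric k m)"
        by (auto simp: mspace_power_metric U_def PiE_iff)
      have "mdist (power_metric k m) x y \<le> r/2"
        unfolding mdist_power_metric_le[OF x y' assms] using y by (auto simp: U_def PiE_iff intro: less_imp_le)
      with r x y' show "y \<in> W" by auto
    qed
    moreover have "x \<in> Pi\<^sub>E {..<k} U"
      using x r by (auto simp: mspace_power_metric U_def PiE_iff mdist_zero[THEN iffD2])
    ultimately show "\<exists>U. finite {i \<in> {..<k}. U i \<noteq> topspace (mtopology_of m)} \<and>
       (\<forall>i\<in>{..<k}. openin (mtopology_of m) (U i)) \<and> x \<in> Pi\<^sub>E {..<k} U \<and> Pi\<^sub>E {..<k} U \<subseteq> W"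
      by (intro exI[of _ U]) (auto simp: U_def openin_mball_of)
  qed
next
  fix W assume W: "openin ?R W"
  have sub: "W \<subseteq> mspace (power_metric k m)"
    using openin_subset[OF W] by (simp add: mspace_power_metric)
  have "\<exists>r>0. mball_of (power_metric k m) x r \<subseteq> W" if "x \<in> W" for x
  proof -
    obtain U where U: "\<And>i. i < k \<Longrightarrow> openin (mtopology_of m) (U i)" "x \<in> Pi\<^sub>E {..<k} U"
        "Pi\<^sub>E {..<k} U \<subseteq> W"
      using W \<open>x \<in> W\<close> unfolding openin_product_topology_alt by (metis lessThan_iff)
    have "\<forall>i\<in>{..<k}. \<exists>r>0. mball_of m (x i) r \<subseteq> U i"
      using U by (auto simp: openin_mtopology_of PiE_iff)
    then obtain r where r: "\<And>i. i < k \<Longrightarrow> 0 < r i \<and> mball_of m (x i) (r i) \<subseteq> U i"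
      by (metis lessThan_iff)
    define R where "R = Min (r ` {..<k})"
    have ne: "finite (r ` {..<k})" "r ` {..<k} \<noteq> {}" using assms by auto
    have "R \<in> r ` {..<k}" unfolding R_def using ne by (rule Min_in)
    then have "0 < R" using r by blast
    have Rle: "R \<le> r i" if "i < k" for i
      unfolding R_def by (rule Min_le[OF ne(1)]) (use that in blast)
    have "mball_of (power_metric k m) x R \<subseteq> W"
    proof
      fix y assume y: "y \<in> mball_of (power_metric k m) x R"
      then have *: "x \<in> mspace (power_metric k m)" "y \<in> mspace (power_metric k m)" by auto
      have "\<forall>i<k. mdist m (x i) (y i) \<le> mdist (power_metric k m) x y"
        using mdist_power_metric_le[OF * assms] by blast
      moreover have "mdist (power_metric k m) x y < R" using y by simp
      ultimately have "mdist m (x i) (y i) < r i" if "i < k" for i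
        using Rle[OF that] that by fastforce
      moreover have "x i \<in> mspace m" "y i \<in> mspace m" if "i < k" for i
        using * that by (auto simp: mspace_power_metric)
      ultimately have "y i \<in> U i" if "i < k" for i
        using r[OF that] that by (meson in_mball_of subsetD)
      moreover have "y \<in> extensional {..<k}"
        using * by (simp add: mspace_power_metric PiE_iff)
      ultimately have "y \<in> Pi\<^sub>E {..<k} U" by (simp add: PiE_iff)
      then show "y \<in> W" using U by blast
    qed
    with \<open>0 < R\<close> show ?thesis by blast
  qed
  with sub show "openin ?L W" by (auto simp: openin_mtopology_of)
qed

lemma mtopology_of_path_metric:
  "mtopology_of (path_metric m) = compact_open_topology (top_of_set {0..1}) (mtopology_of m)"
    (is "?L = ?R")
proof (rule topology_eq[THEN iffD2], intro allI iffI)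
  fix W assume W: "openin ?L W"
  define V where "V K U = {f \<in> extensional {0..1::real}.
      continuous_map (top_of_set {0..1}) (mtopology_of m) f \<and> f ` K \<subseteq> U}" for K U
  have V: "openin ?R (V K U)" if "compact K" "K \<subseteq> {0..1}" "openin (mtopology_of m) U" for K U
    unfolding compact_open_topology_def V_def
    by (rule topology_generated_by_Basis) (use that in \<open>auto simp: compactin_subtopology\<close>)
  show "openin ?R W"
  proof (subst openin_subopen, intro ballI)
    fix f assume "f \<in> W"
    then obtain r where r: "0 < r" "mball_of (path_metric m) f r \<subseteq> W"
      using W by (auto simp: openin_mtopology_of)
    have f: "f \<in> mspace (path_metric m)" using W \<open>f \<in> W\<close> by (auto simp: openin_mtopology_of)
    have "uniformly_continuous_map (submetric euclidean_metric {0..1}) m f"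
      using f by (intro continuous_imp_uniformly_continuous_map)
        (auto simp: mspace_path_metric mtopology_of_submetric compact_space_subtopology)
    then obtain \<delta> where \<delta>: "0 < \<delta>"
        "\<And>s t. s \<in> {0..1} \<Longrightarrow> t \<in> {0..1} \<Longrightarrow> dist t s < \<delta> \<Longrightarrow> mdist m (f t) (f s) < r/3"
      using r by (auto simp: uniformly_continuous_map_def dest!: spec[of _ "r/3"])
    obtain n' :: nat where n': "1 / real (Suc n') < \<delta>"
      using nat_approx_posE[OF \<delta>(1)] by blast
    obtain n :: nat where n: "0 < n" "1 / n < \<delta>"
      by (rule that[of "Suc n'"]) (use n' in auto)
    define K where "K i = {real i / n .. (real i + 1) / n}" for i
    have K: "K i \<subseteq> {0..1}" if "i < n" for i
      using that n by (auto simp: K_def field_simps)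
    define N where "N = (\<Inter>i\<in>{..<n}. V (K i) (mball_of m (f (i / n)) (r/3)))"
    have fm: "f t \<in> mspace m" if "t \<in> {0..1}" for t
      using f that by (auto simp: mspace_path_metric continuous_map_def)
    have "openin ?R N"
      unfolding N_def using n K
      by (intro openin_INT2) (auto intro!: V simp: openin_mball_of, auto simp: K_def)
    moreover have "f \<in> N"
    proof -
      have "f t \<in> mball_of m (f (i / n)) (r/3)" if "i < n" "t \<in> K i" for i t
      proof -
        have "real i / n \<in> {0..1}" "t \<in> {0..1}" using K[OF that(1)] that n
          by (auto simp: field_simps)
        moreover have "dist (real i / n) t < \<delta>"
          using that n by (auto simp: K_def dist_real_def add_divide_distrib)
        ultimately show ?thesis using \<delta>(2) fm by auto
      qed
      then show ?thesis using f by (auto simp: N_def V_def mspace_path_metric)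
    qed
    moreover have "N \<subseteq> W"
    proof
      fix g assume g: "g \<in> N"
      then have g': "g \<in> mspace (path_metric m)" using n by (auto simp: N_def V_def mspace_path_metric)
      have "mdist m (f t) (g t) \<le> 2 * r / 3" if t: "t \<in> {0..1}" for t
      proof -
        have "\<exists>i<n. t \<in> K i"
        proof (cases "t = 1")
          case True
          have "real (n - 1) + 1 = real n" using n by simp
          then have "t \<in> K (n - 1)" using True n by (simp add: K_def divide_le_eq)
          then show ?thesis using n by (intro exI[of _ "n - 1"]) simp
        next
          case False
          then have "0 \<le> t * n" "t * n < n" using t n by auto
          then have "real (nat \<lfloor>t * n\<rfloor>) \<le> t * n" "t * n < real (nat \<lfloor>t * n\<rfloor>) + 1"
            by linarith+
          then have "nat \<lfloor>t * n\<rfloor> < n" "t \<in> K (nat \<lfloor>t * n\<rfloor>)"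
            using n \<open>t * n < n\<close> by (auto simp: K_def divide_le_eq le_divide_eq)
          then show ?thesis by blast
        qed
        then obtain i where i: "i < n" "t \<in> K i" by auto
        have "g t \<in> mball_of m (f (i / n)) (r/3)" "f t \<in> mball_of m (f (i / n)) (r/3)"
          using g \<open>f \<in> N\<close> i unfolding N_def V_def by blast+
        then have "mdist m (f (i / n)) (g t) < r/3" "mdist m (f (i / n)) (f t) < r/3"
          "f (i / n) \<in> mspace m" "f t \<in> mspace m" "g t \<in> mspace m"
          by auto
        then show ?thesis
          using mdist_triangle[of "f t" m "f (i / n)" "g t"] mdist_commute[of m "f t" "f (i / n)"] by linarith
      qed
      then have "mdist (path_metric m) f g \<le> 2 * r / 3"
        by (intro mdist_path_metric_le[OF f g', THEN iffD2] ballI)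
      then show "g \<in> W" using r f g' by auto
    qed
    ultimately show "\<exists>T. openin ?R T \<and> f \<in> T \<and> T \<subseteq> W" by blast
  qed
next
  fix W assume "openin ?R W"
  moreover have "continuous_map ?L ?R id"
    unfolding compact_open_topology_def
  proof (rule continuous_on_generated_topo)
    let ?S = "{{f \<in> extensional (topspace (top_of_set {0..1::real})).
        continuous_map (top_of_set {0..1}) (mtopology_of m) f \<and> f ` K \<subseteq> U} | K U.
        compactin (top_of_set {0..1}) K \<and> openin (mtopology_of m) U}"
    fix N assume "N \<in> ?S"
    then obtain K U where K: "compactin (top_of_set {0..1}) K" and U: "openin (mtopology_of m) U"
      and N: "N = {f \<in> mspace (path_metric m). f ` K \<subseteq> U}"
      by (auto simp: mspace_path_metric)
    have "openin ?L N"
      unfolding openin_mtopology_of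
    proof (intro conjI ballI)
      show "N \<subseteq> mspace (path_metric m)" using N by auto
      fix f assume "f \<in> N"
      then have f: "f \<in> mspace (path_metric m)" "f ` K \<subseteq> U" using N by auto
      have "compactin (mtopology_of m) (f ` K)"
        using K f by (auto simp: mspace_path_metric intro: image_compactin)
      then obtain e where e: "0 < e" "\<And>x. x \<in> f ` K \<Longrightarrow> mball_of m x e \<subseteq> U"
        using Metric_space.lebesgue_number[OF Metric_space_mspace_mdist, of m "f ` K" "{U}"] f U
        unfolding mtopology_of_def mball_of_def by auto
      have "mball_of (path_metric m) f e \<subseteq> N"
      proof
        fix g assume g: "g \<in> mball_of (path_metric m) f e"
        have "g t \<in> U" if "t \<in> K" for t
        proof -
          have t: "t \<in> {0..1}" using K that by (auto simp: compactin_subtopology)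
          have "mdist m (f t) (g t) < e"
            using mdist_path_metric_le[of f m g "mdist (path_metric m) f g"] g t by force
          moreover have "f t \<in> mspace m" "g t \<in> mspace m"
            using g t by (auto simp: mspace_path_metric continuous_map_def)
          ultimately show ?thesis using e(2)[of "f t"] that by auto
        qed
        then show "g \<in> N" using g N by auto
      qed
      with e show "\<exists>r>0. mball_of (path_metric m) f r \<subseteq> N" by auto
    qed
    then show "openin ?L (id -` N \<inter> topspace ?L)"
      using openin_topspace[of ?L] by (simp only: vimage_id id_apply openin_Int)
  next
    show "id ` topspace ?L \<subseteq> \<Union> {{f \<in> extensional (topspace (top_of_set {0..1::real})).
        continuous_map (top_of_set {0..1}) (mtopology_of m) f \<and> f ` K \<subseteq> U} | K U.
        compactin (top_of_set {0..1}) K \<and> openin (mtopology_of m) U}"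
    proof
      fix f assume "f \<in> id ` topspace ?L"
      then show "f \<in> \<Union> {{f \<in> extensional (topspace (top_of_set {0..1::real})).
        continuous_map (top_of_set {0..1}) (mtopology_of m) f \<and> f ` K \<subseteq> U} | K U.
        compactin (top_of_set {0..1}) K \<and> openin (mtopology_of m) U}"
        by (intro UnionI[of "{f \<in> extensional (topspace (top_of_set {0..1::real})).
          continuous_map (top_of_set {0..1}) (mtopology_of m) f \<and> f ` {} \<subseteq> {}}"])
          (auto simp: mspace_path_metric)
    qed
  qed
  ultimately have "openin ?L {f \<in> topspace ?L. id f \<in> W}" "W \<subseteq> topspace ?R"
    using openin_continuous_map_preimage openin_subset by blast+
  moreover have "topspace ?R \<subseteq> topspace ?L"
    by (auto simp: compact_open_topology_def mspace_path_metric)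
  ultimately have *: "openin ?L {f \<in> topspace ?L. id f \<in> W}"
    and **: "{f \<in> topspace ?L. id f \<in> W} = W"
    by auto
  show "openin ?L W" using * unfolding ** .
qed


section \<open>Distributional topological complexities and category\<close>

definition path_eval :: "nat \<Rightarrow> (real \<Rightarrow> 'a) \<Rightarrow> (nat \<Rightarrow> 'a)" where
  "path_eval r \<gamma> = (\<lambda>i\<in>{..<r}. \<gamma> (real i / real (r - 1)))"

definition fibre_paths :: "'e metric \<Rightarrow> ('e \<Rightarrow> 'b) \<Rightarrow> (real \<Rightarrow> 'e) metric" where
  "fibre_paths m p =
     submetric (path_metric m) {\<gamma>. \<exists>x. \<forall>t\<in>{0..1}. p (\<gamma> t) = x}"

definition fibre_power :: "nat \<Rightarrow> 'e metric \<Rightarrow> ('e \<Rightarrow> 'b) \<Rightarrow> (nat \<Rightarrow> 'e) topology" where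
  "fibre_power r m p =
     subtopology (product_topology (\<lambda>_. mtopology_of m) {..<r}) {e. \<forall>i<r. \<forall>j<r. p (e i) = p (e j)}"

definition dTC_parametrized :: "nat \<Rightarrow> 'e metric \<Rightarrow> ('e \<Rightarrow> 'b) \<Rightarrow> enat" where
  "dTC_parametrized r m p = dsecat (fibre_paths m p) (path_eval r) (fibre_power r m p)"

definition dTC :: "nat \<Rightarrow> 'a metric \<Rightarrow> enat" where
  "dTC r m = dsecat (path_metric m) (path_eval r) (product_topology (\<lambda>_. mtopology_of m) {..<r})"

definition dcat :: "'a metric \<Rightarrow> 'a \<Rightarrow> enat" where
  "dcat m x0 = dsecat (submetric (path_metric m) {\<phi>. \<phi> 1 = x0}) (\<lambda>\<phi>. \<phi> 0) (mtopology_of m)"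


section \<open>Topological groups and principal bundles\<close>

definition topological_group :: "('g, 'u) monoid_scheme \<Rightarrow> 'g topology \<Rightarrow> bool" where
  "topological_group G T \<longleftrightarrow>
     group G \<and> topspace T = carrier G \<and>
     continuous_map (prod_topology T T) T (\<lambda>(g, h). g \<otimes>\<^bsub>G\<^esub> h) \<and>
     continuous_map T T (\<lambda>g. inv\<^bsub>G\<^esub> g)"

text \<open>A locally trivial principal bundle, with \<open>act\<close> the right action of \<open>G\<close> on the total space.\<close>
definition principal_bundle ::
  "('g, 'u) monoid_scheme \<Rightarrow> 'g topology \<Rightarrow> 'e topology \<Rightarrow> 'b topology \<Rightarrow>
     ('e \<Rightarrow> 'b) \<Rightarrow> ('e \<Rightarrow> 'g \<Rightarrow> 'e) \<Rightarrow> bool" where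
  "principal_bundle G T E B p act \<longleftrightarrow>
     topological_group G T \<and>
     continuous_map E B p \<and>
     continuous_map (prod_topology E T) E (\<lambda>(e, g). act e g) \<and>
     (\<forall>e \<in> topspace E. act e \<one>\<^bsub>G\<^esub> = e) \<and>
     (\<forall>e \<in> topspace E. \<forall>g \<in> carrier G. \<forall>h \<in> carrier G. act (act e g) h = act e (g \<otimes>\<^bsub>G\<^esub> h)) \<and>
     (\<forall>e \<in> topspace E. \<forall>g \<in> carrier G. p (act e g) = p e) \<and>
     (\<forall>b \<in> topspace B. \<exists>U \<phi>. openin B U \<and> b \<in> U \<and>
        homeomorphic_map (prod_topology (subtopology B U) T)
          (subtopology E {e \<in> topspace E. p e \<in> U}) \<phi> \<and>
        (\<forall>x \<in> U. \<forall>g \<in> carrier G. p (\<phi> (x, g)) = x \<and>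
           (\<forall>h \<in> carrier G. \<phi> (x, g \<otimes>\<^bsub>G\<^esub> h) = act (\<phi> (x, g)) h)))"

end

theory Submission
  imports Defs
begin

text \<open>
  A continuous fibrewise map from a pullback of one fibration to another pushes distributional
  sections forward, so it bounds the distributional sectional category of the target fibration by that of the
  source.  This gives a cycle of inequalities.
  Restricting to one fibre, which is a copy of \<open>G\<close>, bounds \<open>dTC\<^sub>r(G)\<close> by \<open>dTC\<^sub>r[p]\<close>.
  Running a path in \<open>G\<close> through \<open>1, x\<^sub>1\<inverse> g\<^sub>1, \<dots>\<close> back from each of its marked points to its origin, and translating by the
  base point \<open>x\<close>, gives a path in \<open>G\<^bsup>r-1\<^esup>\<close> from \<open>g\<close> to \<open>x\<close>; this bounds \<open>dcat(G\<^bsup>r-1\<^esup>)\<close> by \<open>dTC\<^sub>r(G)\<close>.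
  Finally, points \<open>e\<^sub>0, \<dots>, e\<^sub>r\<^sub>-\<^sub>1\<close> of one fibre are \<open>e\<^sub>j = e\<^sub>0 h\<^sub>j\<close> with \<open>h\<^sub>j\<close> continuous in \<open>(e\<^sub>0, e\<^sub>j)\<close>.
  If \<open>\<psi>\<^sub>j\<close> is a path in \<open>G\<close> from \<open>1\<close> to \<open>h\<^sub>j\<close> and \<open>\<tau>\<^sub>j\<close> is the tent function on \<open>[0,1]\<close> that is 1 at
  \<open>j/(r-1)\<close> and 0 at the other marked times, then
  \<open>e\<^sub>0 \<psi>\<^sub>1(\<tau>\<^sub>1(t)) \<cdots> \<psi>\<^sub>r\<^sub>-\<^sub>1(\<tau>\<^sub>r\<^sub>-\<^sub>1(t))\<close> is a path in the fibre through all the \<open>e\<^sub>j\<close>,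
  which bounds \<open>dTC\<^sub>r[p]\<close> by \<open>dcat(G\<^bsup>r-1\<^esup>)\<close>.
\<close>

section \<open>Pushing forward finitely supported measures\<close>

lemma continuous_map_mtopology_of:
  "continuous_map X (mtopology_of m) f \<longleftrightarrow>
     (\<forall>x \<in> topspace X. \<forall>\<epsilon>>0. \<exists>U. openin X U \<and> x \<in> U \<and> (\<forall>y\<in>U. f y \<in> mball_of m (f x) \<epsilon>))"
  by (simp add: mtopology_of_def mball_of_def
      Metric_space.continuous_map_to_metric[OF Metric_space_mspace_mdist])

lemma finite_in_borel_sets_of:
  assumes "finite A" "A \<subseteq> mspace m"
  shows "A \<in> borel_sets_of m"
  using assms
proof (induction A rule: finite_induct)
  case empty
  then show ?case by (simp add: borel_sets_of_def sigma_sets.Empty)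
next
  case (insert x A)
  have "{x} \<union> A \<in> borel_sets_of m"
    using insert borel_sets_of_singleton[of x m] unfolding borel_sets_of_def
    by (intro sigma_sets_Un) auto
  then show ?case by simp
qed

lemma measure_pmf_mono_support:
  assumes "\<And>x. x \<in> set_pmf \<mu> \<Longrightarrow> x \<in> A \<Longrightarrow> x \<in> B"
  shows "measure_pmf.prob \<mu> A \<le> measure_pmf.prob \<mu> B"
  using assms by (intro measure_pmf.finite_measure_mono_AE) (auto simp: AE_measure_pmf_iff)

text \<open>
  Testing closeness on the finite Borel set \<open>supp \<nu> \<inter> f\<inverse> A\<close> avoids any measurability or global
  continuity of \<open>f\<close> and \<open>g\<close>.
\<close>
lemma prob_map_pmf_le_thickening:
  assumes \<nu>: "finite (set_pmf \<nu>)" "set_pmf \<nu> \<subseteq> mspace m"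
    and close: "lp_close m \<delta> \<nu> \<rho>" and "\<delta> \<le> \<epsilon>"
    and near: "\<And>x y. x \<in> set_pmf \<nu> \<Longrightarrow> y \<in> set_pmf \<rho> \<Longrightarrow> mdist m x y < \<delta> \<Longrightarrow>
      g y \<in> mspace m' \<and> mdist m' (f x) (g y) < \<epsilon>"
  shows "measure_pmf.prob (map_pmf f \<nu>) A \<le>
    measure_pmf.prob (map_pmf g \<rho>) (metric_thickening m' \<epsilon> A) + \<epsilon>"
proof -
  define Z where "Z = set_pmf \<nu> \<inter> f -` A"
  have "measure_pmf.prob (map_pmf f \<nu>) A \<le> measure_pmf.prob \<nu> Z"
    unfolding measure_map_pmf by (rule measure_pmf_mono_support) (auto simp: Z_def)
  also have "Z \<in> borel_sets_of m"
    by (rule finite_in_borel_sets_of) (use \<nu> in \<open>auto simp: Z_def\<close>)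
  then have "measure_pmf.prob \<nu> Z \<le> measure_pmf.prob \<rho> (metric_thickening m \<delta> Z) + \<delta>"
    using close by (auto simp: lp_close_def)
  also have "measure_pmf.prob \<rho> (metric_thickening m \<delta> Z)
      \<le> measure_pmf.prob \<rho> (g -` metric_thickening m' \<epsilon> A)"
    by (rule measure_pmf_mono_support) (use near in \<open>auto simp: Z_def metric_thickening_def\<close>)
  finally show ?thesis using \<open>\<delta> \<le> \<epsilon>\<close> by simp
qed

text \<open>Each support is finite, so continuity of \<open>F\<close> at the finitely many pairs
  \<open>(a, x)\<close> yields one common radius, which takes the place of uniform continuity.
  \<open>D\<close> stands for the pullback on which the fibrewise maps of \<open>dsecat_le\<close>
  make sense.\<close>

lemma continuous_map_map_pmf:
  fixes F :: "'a \<times> 'x \<Rightarrow> 'y"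
  assumes \<mu>: "continuous_map A (mtopology_of (finite_prob_metric k m)) \<mu>"
    and F: "continuous_map (subtopology (prod_topology A (mtopology_of m)) D) (mtopology_of m') F"
    and D: "\<And>a x. a \<in> topspace A \<Longrightarrow> x \<in> set_pmf (\<mu> a) \<Longrightarrow> (a, x) \<in> D"
  shows "continuous_map A (mtopology_of (finite_prob_metric k m'))
    (\<lambda>a. map_pmf (\<lambda>x. F (a, x)) (\<mu> a))"
proof -
  have fin: "set_pmf (\<mu> a) \<subseteq> mspace m" "finite (set_pmf (\<mu> a))" "card (set_pmf (\<mu> a)) \<le> k"
    if "a \<in> topspace A" for a
    using continuous_map_funspace[OF \<mu>] that by (auto simp: Pi_iff finite_prob_def)
  have Fin: "F (a, x) \<in> mspace m'" if "a \<in> topspace A" "x \<in> set_pmf (\<mu> a)" for a x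
    using continuous_map_funspace[OF F] that D[OF that] fin[of a] by (auto simp: Pi_iff)
  have mem: "map_pmf (\<lambda>x. F (a, x)) (\<mu> a) \<in> finite_prob k m'" if "a \<in> topspace A" for a
    using fin[OF that] Fin[OF that] card_image_le[of "set_pmf (\<mu> a)" "\<lambda>x. F (a, x)"]
    by (auto simp: finite_prob_def)
  show ?thesis
    unfolding continuous_map_mtopology_of
  proof (intro ballI allI impI)
    fix a and \<epsilon> :: real assume a: "a \<in> topspace A" and "0 < \<epsilon>"
    \<comment> \<open>A separate modulus for each support point: continuity on the subspace
      \<open>D\<close> gives a product neighbourhood of \<open>(a, x)\<close>. The target
      \<open>\<epsilon>/2\<close> leaves room for the strict inequality at the end.\<close>
    have "\<exists>U \<delta>. openin A U \<and> a \<in> U \<and> 0 < \<delta> \<and>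
        (\<forall>b\<in>U. \<forall>y. (b, y) \<in> D \<longrightarrow> y \<in> mball_of m x \<delta> \<longrightarrow> F (b, y) \<in> mball_of m' (F (a, x)) (\<epsilon>/2))"
      if x: "x \<in> set_pmf (\<mu> a)" for x
    proof -
      have "(a, x) \<in> topspace (subtopology (prod_topology A (mtopology_of m)) D)"
        using a x fin(1)[OF a] D[OF a x] by auto
      then obtain W where W: "openin (subtopology (prod_topology A (mtopology_of m)) D) W" "(a, x) \<in> W"
        "\<forall>z\<in>W. F z \<in> mball_of m' (F (a, x)) (\<epsilon>/2)"
        using F[unfolded continuous_map_mtopology_of] \<open>0 < \<epsilon>\<close> by (metis half_gt_zero)
      obtain W' where W': "openin (prod_topology A (mtopology_of m)) W'" "W = W' \<inter> D"
        using W(1) by (auto simp: openin_subtopology)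
      have "(a, x) \<in> W'" using W(2) W'(2) by simp
      then obtain U V where UV: "openin A U" "openin (mtopology_of m) V" "a \<in> U" "x \<in> V" "U \<times> V \<subseteq> W'"
        using W'(1)[unfolded openin_prod_topology_alt, rule_format] by metis
      then obtain \<delta> where "0 < \<delta>" "mball_of m x \<delta> \<subseteq> V"
        by (auto simp: openin_mtopology_of)
      then show ?thesis using UV W W' by (intro exI[of _ U] exI[of _ \<delta>]) blast
    qed
    then obtain U \<delta> where U\<delta>: "\<And>x. x \<in> set_pmf (\<mu> a) \<Longrightarrow> openin A (U x) \<and> a \<in> U x \<and> 0 < \<delta> x \<and>
        (\<forall>b\<in>U x. \<forall>y. (b, y) \<in> D \<longrightarrow> y \<in> mball_of m x (\<delta> x) \<longrightarrow> F (b, y) \<in> mball_of m' (F (a, x)) (\<epsilon>/2))"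
      by metis
    \<comment> \<open>The entry \<open>\<epsilon>/2\<close> keeps the closeness parameter
      \<open>c < d\<close> below the target \<open>\<epsilon>/2\<close>; the other entries ensure
      that any \<open>y\<close> within \<open>c\<close> of a support point \<open>x\<close> is
      covered by the modulus at \<open>x\<close>.\<close>
    define d where "d = Min (insert (\<epsilon>/2) (\<delta> ` set_pmf (\<mu> a)))"
    have "finite (insert (\<epsilon>/2) (\<delta> ` set_pmf (\<mu> a)))" using fin(2)[OF a] by simp
    then have d: "d \<le> \<epsilon>/2" "\<And>x. x \<in> set_pmf (\<mu> a) \<Longrightarrow> d \<le> \<delta> x" and "0 < d"
      unfolding d_def using U\<delta> \<open>0 < \<epsilon>\<close> by (blast intro: Min_le, blast intro: Min_le, simp)
    obtain V where V: "openin A V" "a \<in> V" "\<forall>b\<in>V. \<mu> b \<in> mball_of (finite_prob_metric k m) (\<mu> a) d"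
      using \<mu>[unfolded continuous_map_mtopology_of] a \<open>0 < d\<close> by metis
    define W where "W = V \<inter> (\<Inter>x\<in>set_pmf (\<mu> a). U x)"
    have "openin A (\<Inter>x\<in>set_pmf (\<mu> a). U x)"
      using fin(2)[OF a] U\<delta> set_pmf_not_empty by (intro openin_INT2) auto
    then have W: "openin A W" "a \<in> W"
      using V U\<delta> by (auto simp: W_def)
    have "map_pmf (\<lambda>x. F (b, x)) (\<mu> b) \<in>
        mball_of (finite_prob_metric k m') (map_pmf (\<lambda>x. F (a, x)) (\<mu> a)) \<epsilon>" if b: "b \<in> W" for b
    proof -
      have bA: "b \<in> topspace A" using b W openin_subset by blast
      have "levy_prokhorov_dist m (\<mu> a) (\<mu> b) < d" using V b by (auto simp: W_def)
      then obtain c where c: "c < d" "lp_close m c (\<mu> a) (\<mu> b)"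
        by (auto simp: levy_prokhorov_dist_less_iff)
      have near: "mdist m' (F (a, x)) (F (b, y)) < \<epsilon>/2"
        if "x \<in> set_pmf (\<mu> a)" "y \<in> set_pmf (\<mu> b)" "mdist m x y < c" for x y
      proof -
        have "y \<in> mball_of m x (\<delta> x)" using that c(1) d(2)[OF that(1)] fin(1)[OF a] fin(1)[OF bA] by auto
        then show ?thesis using U\<delta>[OF that(1)] b D[OF bA that(2)] that(1) by (auto simp: W_def)
      qed
      have "lp_close m' (\<epsilon>/2) (map_pmf (\<lambda>x. F (a, x)) (\<mu> a)) (map_pmf (\<lambda>x. F (b, x)) (\<mu> b))"
        unfolding lp_close_def
      proof (intro conjI ballI)
        fix S
        show "measure_pmf.prob (map_pmf (\<lambda>x. F (a, x)) (\<mu> a)) S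
          \<le> measure_pmf.prob (map_pmf (\<lambda>x. F (b, x)) (\<mu> b)) (metric_thickening m' (\<epsilon>/2) S) + \<epsilon>/2"
          by (rule prob_map_pmf_le_thickening[OF fin(2,1)[OF a] c(2)])
            (use c d(1) near Fin bA in auto)
        \<comment> \<open>The moduli are anchored at support points of \<open>\<mu> a\<close> only,
          but \<open>near\<close> is symmetric up to commuting \<open>mdist\<close>, so it serves
          this direction as well.\<close>
        show "measure_pmf.prob (map_pmf (\<lambda>x. F (b, x)) (\<mu> b)) S
          \<le> measure_pmf.prob (map_pmf (\<lambda>x. F (a, x)) (\<mu> a)) (metric_thickening m' (\<epsilon>/2) S) + \<epsilon>/2"
          by (rule prob_map_pmf_le_thickening[OF fin(2,1)[OF bA] c(2)[unfolded lp_close_sym[of _ _ "\<mu> a"]]])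
            (use c d(1) near Fin a in \<open>auto simp: mdist_commute\<close>)
      qed (use \<open>0 < \<epsilon>\<close> in simp)
      then have "levy_prokhorov_dist m' (map_pmf (\<lambda>x. F (a, x)) (\<mu> a)) (map_pmf (\<lambda>x. F (b, x)) (\<mu> b)) < \<epsilon>"
        using \<open>0 < \<epsilon>\<close> by (auto simp: levy_prokhorov_dist_less_iff intro!: exI[of _ "\<epsilon>/2"])
      then show ?thesis using mem[OF a] mem[OF bA] by simp
    qed
    then show "\<exists>U. openin A U \<and> a \<in> U \<and> (\<forall>b\<in>U. map_pmf (\<lambda>x. F (b, x)) (\<mu> b) \<in>
        mball_of (finite_prob_metric k m') (map_pmf (\<lambda>x. F (a, x)) (\<mu> a)) \<epsilon>)"
      using W by blast
  qed
qed

text \<open>A section of the source supplies, over \<open>f b\<close>, a measure on a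
  \<open>p\<close>-fibre, and \<open>F\<close> with first argument \<open>b\<close> carries it into
  the \<open>p'\<close>-fibre over \<open>b\<close>. Taking images does not enlarge a finite
  support, so the same \<open>n\<close> works for the target.\<close>

lemma dsecat_le:
  fixes m :: "'x metric" and m' :: "'y metric" and p :: "'x \<Rightarrow> 'b" and p' :: "'y \<Rightarrow> 'c"
  assumes f: "continuous_map B' B f"
    and F: "continuous_map (subtopology (prod_topology B' (mtopology_of m)) {(b, x). p x = f b})
      (mtopology_of m') F"
    and p': "\<And>b x. b \<in> topspace B' \<Longrightarrow> x \<in> mspace m \<Longrightarrow> p x = f b \<Longrightarrow> p' (F (b, x)) = b"
  shows "dsecat m' p' B' \<le> dsecat m p B"
  unfolding dsecat_def
proof (rule INF_mono)
  fix n assume "n \<in> {n. \<exists>s. continuous_map B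
       (subtopology (mtopology_of (finite_prob_metric (n + 1) m)) (fibrewise_prob (n + 1) m p B)) s \<and>
      (\<forall>b\<in>topspace B. fibrewise_prob_map p (s b) = b)}"
  then obtain s where s: "continuous_map B (mtopology_of (finite_prob_metric (n + 1) m)) s"
      "\<And>b. b \<in> topspace B \<Longrightarrow> s b \<in> fibrewise_prob (n + 1) m p B"
      "\<And>b. b \<in> topspace B \<Longrightarrow> fibrewise_prob_map p (s b) = b"
    by (auto simp: continuous_map_in_subtopology)
  have fB: "f b \<in> topspace B" if "b \<in> topspace B'" for b
    using continuous_map_funspace[OF f] that by auto
  \<comment> \<open>Membership in \<open>fibrewise_prob\<close> only places the support in some
    fibre; the section equation identifies it as the one over \<open>f b\<close>.\<close>
  have supp: "x \<in> mspace m" "p x = f b" if b: "b \<in> topspace B'" and x: "x \<in> set_pmf (s (f b))" for b x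
  proof -
    obtain c where c: "set_pmf (s (f b)) \<subseteq> {e \<in> mspace m. p e = c}"
      using s(2)[OF fB[OF b]] by (auto simp: fibrewise_prob_def)
    then have "c = f b"
      using s(3)[OF fB[OF b]] fibrewise_prob_map_eqI[of "s (f b)" p c] by auto
    then show "x \<in> mspace m" "p x = f b" using c x by auto
  qed
  define s' where "s' b = map_pmf (\<lambda>x. F (b, x)) (s (f b))" for b
  have cont: "continuous_map B' (mtopology_of (finite_prob_metric (n + 1) m')) s'"
    unfolding s'_def
    by (rule continuous_map_map_pmf[OF continuous_map_compose[OF f s(1), unfolded o_def] F])
      (use supp in auto)
  have supp': "set_pmf (s' b) \<subseteq> {e \<in> mspace m'. p' e = b}" if "b \<in> topspace B'" for b
  proof -
    have "set_pmf (s' b) \<subseteq> mspace m'"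
      using continuous_map_funspace[OF cont] that by (auto simp: Pi_iff finite_prob_def)
    then show ?thesis using supp[OF that] p'[OF that] by (auto simp: s'_def)
  qed
  have "s' b \<in> fibrewise_prob (n + 1) m' p' B'" if "b \<in> topspace B'" for b
    using supp'[OF that] continuous_map_funspace[OF cont] that
    by (auto simp: fibrewise_prob_def Pi_iff)
  moreover have "fibrewise_prob_map p' (s' b) = b" if "b \<in> topspace B'" for b
    using supp'[OF that] by (intro fibrewise_prob_map_eqI) auto
  ultimately have "n \<in> {n. \<exists>s. continuous_map B'
       (subtopology (mtopology_of (finite_prob_metric (n + 1) m')) (fibrewise_prob (n + 1) m' p' B')) s \<and>
      (\<forall>b\<in>topspace B'. fibrewise_prob_map p' (s b) = b)}"
    using cont by (auto simp: continuous_map_in_subtopology)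
  then show "\<exists>k\<in>{n. \<exists>s. continuous_map B'
       (subtopology (mtopology_of (finite_prob_metric (n + 1) m')) (fibrewise_prob (n + 1) m' p' B')) s \<and>
      (\<forall>b\<in>topspace B'. fibrewise_prob_map p' (s b) = b)}. enat k \<le> enat n"
    by blast
qed

section \<open>Maps into and out of path spaces\<close>

text \<open>One half of the exponential law. The compact-open description of the metric topology
  reduces it to subbasic sets, where a tube-lemma argument applies.\<close>

lemma continuous_map_path_metric:
  assumes H: "continuous_map (prod_topology A (top_of_set {0..1})) (mtopology_of m) (\<lambda>z. h (fst z) (snd z))"
  shows "continuous_map A (mtopology_of (path_metric m)) (\<lambda>a. restrict (h a) {0..1})"
proof -
  have path: "continuous_map (top_of_set {0..1}) (mtopology_of m) (restrict (h a) {0..1})"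
    if "a \<in> topspace A" for a
  proof -
    have "continuous_map (top_of_set {0..1}) (prod_topology A (top_of_set {0..1})) (\<lambda>t::real. (a, t))"
      using that by (intro continuous_map_pairedI) auto
    from continuous_map_compose[OF this H] show ?thesis
      by (rule continuous_map_eq) auto
  qed
  show ?thesis
    unfolding mtopology_of_path_metric compact_open_topology_def
  proof (rule continuous_on_generated_topo, goal_cases)
    case (1 W)
    then obtain K U where K: "compactin (top_of_set {0..1::real}) K" and U: "openin (mtopology_of m) U"
      and W: "W = {f \<in> extensional {0..1}. continuous_map (top_of_set {0..1}) (mtopology_of m) f \<and> f ` K \<subseteq> U}"
      by auto
    have KI: "K \<subseteq> {0..1}" using compactin_subset_topspace[OF K] by simp
    \<comment> \<open>The pairs at which \<open>h\<close> leaves \<open>U\<close> during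
      \<open>K\<close>; the parameters to be excluded are exactly the projection of
      \<open>C\<close>.\<close>
    define C where "C = {z \<in> topspace (prod_topology A (top_of_set K)). h (fst z) (snd z) \<in> mspace m - U}"
    have "continuous_map (prod_topology A (top_of_set K)) (mtopology_of m) (\<lambda>z. h (fst z) (snd z))"
      using continuous_map_from_subtopology[OF H, of "topspace A \<times> K"] KI
      by (simp add: prod_topology_subtopology(2) subtopology_subtopology Int_absorb1 Times_Int_Times
          flip: prod_topology_subtopology(2))
    moreover have "closedin (mtopology_of m) (mspace m - U)"
      using closedin_diff[OF closedin_topspace U] by simp
    ultimately have "closedin (prod_topology A (top_of_set K)) C"
      unfolding C_def by (rule closedin_continuous_map_preimage)
    \<comment> \<open>Compactness of \<open>K\<close> enters here: projecting along a compact factor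
      preserves closed sets.\<close>
    moreover have "closed_map (prod_topology A (top_of_set K)) A fst"
      using K by (intro Abstract_Topological_Spaces.closed_map_fst) (auto simp: compactin_subtopology compact_space_subtopology)
    ultimately have "closedin A (fst ` C)" by (simp add: closed_map_def)
    then have "openin A (topspace A - fst ` C)" by blast
    moreover have "(\<lambda>a. restrict (h a) {0..1}) -` W \<inter> topspace A = topspace A - fst ` C"
    proof -
      have "h a t \<in> mspace m" if "a \<in> topspace A" "t \<in> K" for a t
        using continuous_map_funspace[OF path[OF that(1)]] that KI by (auto simp: Pi_iff)
      then have "a \<in> fst ` C \<longleftrightarrow> \<not> h a ` K \<subseteq> U" if "a \<in> topspace A" for a
        using that KI by (force simp: C_def image_iff)
      moreover have "restrict (h a) {0..1} ` K = h a ` K" for a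
        using KI by (intro image_cong) auto
      ultimately have "a \<in> (\<lambda>a. restrict (h a) {0..1}) -` W \<inter> topspace A \<longleftrightarrow> a \<in> topspace A - fst ` C" for a
        using path[of a] by (cases "a \<in> topspace A") (simp_all only: W vimage_eq mem_Collect_eq restrict_extensional
          Int_iff Diff_iff not_not simp_thms)
      then show ?thesis by blast
    qed
    ultimately show ?case by simp
  next
    case 2
    show ?case
    proof (rule image_subsetI)
      fix a assume "a \<in> topspace A"
      \<comment> \<open>The empty compact set imposes no condition, so its subbasic set contains
        every path; this settles the covering condition.\<close>
      moreover have "compactin (top_of_set {0..1::real}) {}" by simp
      ultimately show "restrict (h a) {0..1} \<in> \<Union> {{f \<in> extensional (topspace (top_of_set {0..1::real})).
          continuous_map (top_of_set {0..1}) (mtopology_of m) f \<and> f ` K \<subseteq> U} | K U.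
          compactin (top_of_set {0..1}) K \<and> openin (mtopology_of m) U}"
        using path[of a]
        by (intro UnionI[of "{f \<in> extensional (topspace (top_of_set {0..1::real})).
            continuous_map (top_of_set {0..1}) (mtopology_of m) f \<and> f ` {} \<subseteq> {}}"])
          (blast intro: openin_empty, simp)
    qed
  qed
qed

text \<open>Evaluation at a moving time is controlled in two moves: first the time changes along the
  fixed path \<open>\<gamma> a\<close>, then the path changes at the fixed time
  \<open>\<tau> b\<close>, at a cost of at most the supremum distance.\<close>

lemma continuous_map_path_apply:
  assumes \<gamma>: "continuous_map A (mtopology_of (path_metric m)) \<gamma>"
    and \<tau>: "continuous_map A (top_of_set {0..1}) \<tau>"
  shows "continuous_map A (mtopology_of m) (\<lambda>a. \<gamma> a (\<tau> a))"
  unfolding continuous_map_mtopology_of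
proof (intro ballI allI impI)
  fix a and \<epsilon> :: real assume a: "a \<in> topspace A" and "0 < \<epsilon>"
  have mem: "\<gamma> b \<in> mspace (path_metric m)" "\<tau> b \<in> {0..1}" "\<gamma> b (\<tau> c) \<in> mspace m"
    if "b \<in> topspace A" "c \<in> topspace A" for b c
    using continuous_map_funspace[OF \<gamma>] continuous_map_funspace[OF \<tau>] that
    by (auto simp: Pi_iff mspace_path_metric continuous_map_def)
  obtain U where U: "openin A U" "a \<in> U" "\<forall>b\<in>U. \<gamma> b \<in> mball_of (path_metric m) (\<gamma> a) (\<epsilon>/2)"
    using \<gamma>[unfolded continuous_map_mtopology_of] a \<open>0 < \<epsilon>\<close> by (metis half_gt_zero)
  have "continuous_map (top_of_set {0..1}) (mtopology_of m) (\<gamma> a)"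
    using mem a by (simp add: mspace_path_metric)
  from continuous_map_compose[OF \<tau> this] obtain V where V: "openin A V" "a \<in> V"
      "\<forall>b\<in>V. \<gamma> a (\<tau> b) \<in> mball_of m (\<gamma> a (\<tau> a)) (\<epsilon>/2)"
    unfolding continuous_map_mtopology_of o_def using a \<open>0 < \<epsilon>\<close> by (metis half_gt_zero)
  have "\<gamma> b (\<tau> b) \<in> mball_of m (\<gamma> a (\<tau> a)) \<epsilon>" if b: "b \<in> U \<inter> V" for b
  proof -
    have bA: "b \<in> topspace A" using b openin_subset[OF U(1)] by auto
    have "mdist m (\<gamma> a (\<tau> b)) (\<gamma> b (\<tau> b)) \<le> mdist (path_metric m) (\<gamma> a) (\<gamma> b)"
      using mdist_path_metric_le[OF mem(1)[OF a a] mem(1)[OF bA bA]] mem(2)[OF bA bA] by blast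
    also have "\<dots> < \<epsilon>/2" using U b by auto
    finally have "mdist m (\<gamma> a (\<tau> a)) (\<gamma> b (\<tau> b)) < \<epsilon>"
      using V b mdist_triangle[OF mem(3)[OF a a] mem(3)[OF a bA] mem(3)[OF bA bA]] by fastforce
    then show ?thesis using mem(3)[OF a a] mem(3)[OF bA bA] by simp
  qed
  then show "\<exists>U. openin A U \<and> a \<in> U \<and> (\<forall>b\<in>U. \<gamma> b (\<tau> b) \<in> mball_of m (\<gamma> a (\<tau> a)) \<epsilon>)"
    using U V by (intro exI[of _ "U \<inter> V"]) auto
qed

lemma continuous_map_locally:
  assumes "\<And>x. x \<in> topspace X \<Longrightarrow> \<exists>U. openin X U \<and> x \<in> U \<and> continuous_map (subtopology X U) Y f"
  shows "continuous_map X Y f"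
proof -
  have "\<forall>x\<in>topspace X. \<exists>U. openin X U \<and> x \<in> U \<and> continuous_map (subtopology X U) Y f"
    using assms by blast
  from bchoice[OF this] obtain U
    where U: "\<forall>x\<in>topspace X. openin X (U x) \<and> x \<in> U x \<and> continuous_map (subtopology X (U x)) Y f" ..
  show ?thesis
    by (rule pasting_lemma[where I = "topspace X" and T = U and f = "\<lambda>_. f"]) (use U in blast)+
qed

section \<open>Topological groups and principal bundles\<close>

locale top_group = group G for G :: "('g, 'u) monoid_scheme" (structure) +
  fixes T :: "'g topology"
  assumes topological_group: "topological_group G T"
begin

lemma topspace_eq: "topspace T = carrier G"
  using topological_group by (simp add: topological_group_def)

lemma continuous_map_mult:
  assumes "continuous_map A T f" "continuous_map A T g"
  shows "continuous_map A T (\<lambda>a. f a \<otimes> g a)"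
proof -
  have "continuous_map (prod_topology T T) T (\<lambda>(g, h). g \<otimes> h)"
    using topological_group by (simp add: topological_group_def)
  from continuous_map_compose[OF continuous_map_pairedI[OF assms] this] show ?thesis
    by (simp add: o_def)
qed

lemma continuous_map_inv:
  assumes "continuous_map A T f"
  shows "continuous_map A T (\<lambda>a. inv (f a))"
proof -
  have "continuous_map T T (\<lambda>g. inv g)"
    using topological_group by (simp add: topological_group_def)
  from continuous_map_compose[OF assms this] show ?thesis by (simp add: o_def)
qed

end

section \<open>Principal bundles, local coordinates and the translation function\<close>

locale principal_G_bundle = top_group G T for G :: "('g, 'u) monoid_scheme" (structure) and T +
  fixes E :: "'e topology" and B :: "'b topology" and p :: "'e \<Rightarrow> 'b" and act :: "'e \<Rightarrow> 'g \<Rightarrow> 'e"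
  assumes principal_bundle: "principal_bundle G T E B p act"
begin

lemma continuous_proj: "continuous_map E B p"
  using principal_bundle by (simp add: principal_bundle_def)

lemma act_one: "e \<in> topspace E \<Longrightarrow> act e \<one> = e"
  using principal_bundle by (simp add: principal_bundle_def)

lemma proj_act: "e \<in> topspace E \<Longrightarrow> g \<in> carrier G \<Longrightarrow> p (act e g) = p e"
  using principal_bundle by (simp add: principal_bundle_def)

lemma continuous_map_act:
  assumes "continuous_map A E f" "continuous_map A T g"
  shows "continuous_map A E (\<lambda>a. act (f a) (g a))"
proof -
  have "continuous_map (prod_topology E T) E (\<lambda>(e, g). act e g)"
    using principal_bundle by (simp add: principal_bundle_def)
  from continuous_map_compose[OF continuous_map_pairedI[OF assms] this] show ?thesis
    by (simp add: o_def)
qed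

lemma act_closed: "e \<in> topspace E \<Longrightarrow> g \<in> carrier G \<Longrightarrow> act e g \<in> topspace E"
  using continuous_map_funspace[OF continuous_map_act[OF continuous_map_fst continuous_map_snd]]
  by (force simp: Pi_iff topspace_eq)

text \<open>\<open>\<kappa>\<close> is the group component of the inverse of a local trivialisation.
  Equivariance and injectivity on fibres are what the translation function is later built
  from.\<close>

lemma local_coordinate:
  assumes "b \<in> topspace B"
  obtains U \<kappa> where "openin B U" "b \<in> U"
    "continuous_map (subtopology E {e \<in> topspace E. p e \<in> U}) T \<kappa>"
    "\<And>e h. e \<in> topspace E \<Longrightarrow> p e \<in> U \<Longrightarrow> h \<in> carrier G \<Longrightarrow> \<kappa> (act e h) = \<kappa> e \<otimes> h"
    "\<And>e e'. e \<in> topspace E \<Longrightarrow> e' \<in> topspace E \<Longrightarrow> p e \<in> U \<Longrightarrow> p e = p e' \<Longrightarrow> \<kappa> e = \<kappa> e' \<Longrightarrow> e = e'"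
proof -
  have "\<exists>U \<phi>. openin B U \<and> b \<in> U \<and>
        homeomorphic_map (prod_topology (subtopology B U) T)
          (subtopology E {e \<in> topspace E. p e \<in> U}) \<phi> \<and>
        (\<forall>x \<in> U. \<forall>g \<in> carrier G. p (\<phi> (x, g)) = x \<and>
           (\<forall>h \<in> carrier G. \<phi> (x, g \<otimes> h) = act (\<phi> (x, g)) h))"
    using principal_bundle assms by (simp add: principal_bundle_def)
  then obtain U \<phi> where U: "openin B U" "b \<in> U"
    and hom: "homeomorphic_map (prod_topology (subtopology B U) T)
      (subtopology E {e \<in> topspace E. p e \<in> U}) \<phi>"
    and \<phi>: "\<And>x g. x \<in> U \<Longrightarrow> g \<in> carrier G \<Longrightarrow> p (\<phi> (x, g)) = x"
      "\<And>x g h. x \<in> U \<Longrightarrow> g \<in> carrier G \<Longrightarrow> h \<in> carrier G \<Longrightarrow> \<phi> (x, g \<otimes> h) = act (\<phi> (x, g)) h"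
    by blast
  obtain \<psi> where \<psi>: "homeomorphic_maps (prod_topology (subtopology B U) T)
      (subtopology E {e \<in> topspace E. p e \<in> U}) \<phi> \<psi>"
    using hom by (auto simp: homeomorphic_map_maps)
  have U_sub: "U \<subseteq> topspace B" using U openin_subset by blast
  have \<psi>\<phi>: "\<psi> (\<phi> (x, g)) = (x, g)" if "x \<in> U" "g \<in> carrier G" for x g
    using \<psi> that U_sub by (auto simp: homeomorphic_maps_def topspace_eq)
  \<comment> \<open>Every point over \<open>U\<close> comes from the trivialisation, and its base
    component is \<open>p e\<close> because \<open>\<phi>\<close> covers the identity of
    \<open>U\<close>.\<close>
  have ex: "\<exists>g \<in> carrier G. e = \<phi> (p e, g) \<and> \<psi> e = (p e, g)" if e: "e \<in> topspace E" "p e \<in> U" for e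
  proof -
    have cont: "continuous_map (subtopology E {e \<in> topspace E. p e \<in> U}) (prod_topology (subtopology B U) T) \<psi>"
      using \<psi> by (simp add: homeomorphic_maps_def)
    obtain x g where xg: "\<psi> e = (x, g)" by fastforce
    moreover have "\<psi> e \<in> topspace (prod_topology (subtopology B U) T)"
      by (rule funcset_mem[OF continuous_map_funspace[OF cont]]) (use e in simp)
    ultimately have "x \<in> U" "g \<in> carrier G" by (simp_all add: topspace_eq)
    moreover have "\<phi> (\<psi> e) = e" using \<psi> e by (auto simp: homeomorphic_maps_def)
    ultimately show ?thesis using \<phi>(1)[of x g] xg by auto
  qed
  show thesis
  proof (rule that[OF U, of "\<lambda>e. snd (\<psi> e)"])
    show "continuous_map (subtopology E {e \<in> topspace E. p e \<in> U}) T (\<lambda>e. snd (\<psi> e))"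
      using \<psi> continuous_map_snd_of[of _ "subtopology B U" T \<psi>] by (simp add: homeomorphic_maps_def o_def)
  next
    fix e h assume e: "e \<in> topspace E" "p e \<in> U" and h: "h \<in> carrier G"
    obtain g where g: "g \<in> carrier G" "e = \<phi> (p e, g)" "\<psi> e = (p e, g)"
      using ex[OF e] by blast
    then have "act e h = \<phi> (p e, g \<otimes> h)" using \<phi>(2)[OF e(2) g(1) h] by simp
    then show "snd (\<psi> (act e h)) = snd (\<psi> e) \<otimes> h" using \<psi>\<phi>[OF e(2)] g h by simp
  next
    fix e e' assume "e \<in> topspace E" "e' \<in> topspace E" "p e \<in> U" "p e = p e'" "snd (\<psi> e) = snd (\<psi> e')"
    then show "e = e'" using ex[of e] ex[of e'] by auto
  qed
qed

lemma total_space_nonempty: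
  assumes "topspace B \<noteq> {}"
  shows "topspace E \<noteq> {}"
proof -
  obtain b where "b \<in> topspace B" using assms by blast
  then obtain U \<phi> where U: "openin B U" "b \<in> U"
    and hom: "homeomorphic_map (prod_topology (subtopology B U) T)
      (subtopology E {e \<in> topspace E. p e \<in> U}) \<phi>"
    using principal_bundle unfolding principal_bundle_def by blast
  have "(b, \<one>) \<in> topspace (prod_topology (subtopology B U) T)"
    using U \<open>b \<in> topspace B\<close> by (simp add: topspace_eq)
  then have "\<phi> (b, \<one>) \<in> topspace E"
    using continuous_map_funspace[OF homeomorphic_imp_continuous_map[OF hom]] by auto
  then show ?thesis by blast
qed

text \<open>Meaningful only if \<open>e\<close> and \<open>e'\<close> lie in the same fibre.\<close>
definition translation :: "'e \<Rightarrow> 'e \<Rightarrow> 'g" where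
  "translation e e' = (THE g. g \<in> carrier G \<and> act e g = e')"

text \<open>In the coordinate \<open>\<kappa>\<close> the equation \<open>act e g = e'\<close>
  becomes \<open>\<kappa> e \<otimes> g = \<kappa> e'\<close>, which has exactly one solution in the
  group. The explicit formula serves continuity; the other three facts express that the action is
  free and transitive on fibres.\<close>

lemma translation_eq:
  assumes \<kappa>: "continuous_map (subtopology E {e \<in> topspace E. p e \<in> U}) T \<kappa>"
    "\<And>e h. e \<in> topspace E \<Longrightarrow> p e \<in> U \<Longrightarrow> h \<in> carrier G \<Longrightarrow> \<kappa> (act e h) = \<kappa> e \<otimes> h"
    "\<And>e e'. e \<in> topspace E \<Longrightarrow> e' \<in> topspace E \<Longrightarrow> p e \<in> U \<Longrightarrow> p e = p e' \<Longrightarrow> \<kappa> e = \<kappa> e' \<Longrightarrow> e = e'"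
    and e: "e \<in> topspace E" "e' \<in> topspace E" "p e \<in> U" "p e = p e'"
  shows "translation e e' = inv (\<kappa> e) \<otimes> \<kappa> e'" "translation e e' \<in> carrier G" "act e (translation e e') = e'"
    "g \<in> carrier G \<Longrightarrow> act e g = e' \<Longrightarrow> translation e e' = g"
proof -
  have \<kappa>G: "\<kappa> e \<in> carrier G" "\<kappa> e' \<in> carrier G"
    using continuous_map_funspace[OF \<kappa>(1)] e by (auto simp: Pi_iff topspace_eq)
  define g0 where "g0 = inv (\<kappa> e) \<otimes> \<kappa> e'"
  have g0: "g0 \<in> carrier G" "\<kappa> e \<otimes> g0 = \<kappa> e'"
    using \<kappa>G by (simp_all add: g0_def inv_solve_left m_assoc[symmetric])
  \<comment> \<open>Both points lie in the same fibre and have the same coordinate, so injectivity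
    of \<open>\<kappa>\<close> on fibres applies.\<close>
  have a: "act e g0 = e'"
    using \<kappa>(2)[OF e(1,3) g0(1)] e g0 by (intro \<kappa>(3)) (auto simp: act_closed proj_act)
  have uniq: "g = g0" if g: "g \<in> carrier G" "act e g = e'" for g
  proof -
    have "\<kappa> e \<otimes> g = \<kappa> e \<otimes> g0" using \<kappa>(2)[OF e(1,3) g(1)] g(2) g0(2) by simp
    then show ?thesis using \<kappa>G g(1) g0(1) by simp
  qed
  have tr: "translation e e' = g0"
    unfolding translation_def by (rule the_equality) (use a g0(1) uniq in blast)+
  show "translation e e' = inv (\<kappa> e) \<otimes> \<kappa> e'" "translation e e' \<in> carrier G" "act e (translation e e') = e'"
    "g \<in> carrier G \<Longrightarrow> act e g = e' \<Longrightarrow> translation e e' = g"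
    unfolding tr by (rule g0_def, rule g0(1), rule a, rule uniq[symmetric])
qed

lemma translation_closed:
  assumes "e \<in> topspace E" "e' \<in> topspace E" "p e = p e'"
  shows "translation e e' \<in> carrier G"
proof -
  have "p e \<in> topspace B" using continuous_map_funspace[OF continuous_proj] assms by auto
  then obtain U \<kappa> where U: "openin B U" "p e \<in> U"
    and \<kappa>: "continuous_map (subtopology E {e \<in> topspace E. p e \<in> U}) T \<kappa>"
    "\<And>e h. e \<in> topspace E \<Longrightarrow> p e \<in> U \<Longrightarrow> h \<in> carrier G \<Longrightarrow> \<kappa> (act e h) = \<kappa> e \<otimes> h"
    "\<And>e e'. e \<in> topspace E \<Longrightarrow> e' \<in> topspace E \<Longrightarrow> p e \<in> U \<Longrightarrow> p e = p e' \<Longrightarrow> \<kappa> e = \<kappa> e' \<Longrightarrow> e = e'"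
    by (rule local_coordinate) blast
  show ?thesis by (rule translation_eq(2)[OF \<kappa> assms(1,2) U(2) assms(3)])
qed

lemma act_translation:
  assumes "e \<in> topspace E" "e' \<in> topspace E" "p e = p e'"
  shows "act e (translation e e') = e'"
proof -
  have "p e \<in> topspace B" using continuous_map_funspace[OF continuous_proj] assms by auto
  then obtain U \<kappa> where U: "openin B U" "p e \<in> U"
    and \<kappa>: "continuous_map (subtopology E {e \<in> topspace E. p e \<in> U}) T \<kappa>"
    "\<And>e h. e \<in> topspace E \<Longrightarrow> p e \<in> U \<Longrightarrow> h \<in> carrier G \<Longrightarrow> \<kappa> (act e h) = \<kappa> e \<otimes> h"
    "\<And>e e'. e \<in> topspace E \<Longrightarrow> e' \<in> topspace E \<Longrightarrow> p e \<in> U \<Longrightarrow> p e = p e' \<Longrightarrow> \<kappa> e = \<kappa> e' \<Longrightarrow> e = e'"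
    by (rule local_coordinate) blast
  show ?thesis by (rule translation_eq(3)[OF \<kappa> assms(1,2) U(2) assms(3)])
qed

lemma translation_act:
  assumes "e \<in> topspace E" "g \<in> carrier G"
  shows "translation e (act e g) = g"
proof -
  have "p e \<in> topspace B" using continuous_map_funspace[OF continuous_proj] assms by auto
  then obtain U \<kappa> where U: "openin B U" "p e \<in> U"
    and \<kappa>: "continuous_map (subtopology E {e \<in> topspace E. p e \<in> U}) T \<kappa>"
    "\<And>e h. e \<in> topspace E \<Longrightarrow> p e \<in> U \<Longrightarrow> h \<in> carrier G \<Longrightarrow> \<kappa> (act e h) = \<kappa> e \<otimes> h"
    "\<And>e e'. e \<in> topspace E \<Longrightarrow> e' \<in> topspace E \<Longrightarrow> p e \<in> U \<Longrightarrow> p e = p e' \<Longrightarrow> \<kappa> e = \<kappa> e' \<Longrightarrow> e = e'"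
    by (rule local_coordinate) blast
  show ?thesis
    by (rule translation_eq(4)[OF \<kappa> assms(1) act_closed[OF assms] U(2) proj_act[OF assms, symmetric] assms(2) refl])
qed

text \<open>Continuity is local, and near a given point one coordinate \<open>\<kappa>\<close>
  serves both \<open>f\<close> and \<open>g\<close>, since they lie over the same point of
  \<open>U\<close>; there the translation is a quotient of two continuous group-valued maps.\<close>

lemma continuous_map_translation:
  assumes f: "continuous_map A E f" and g: "continuous_map A E g"
    and eq: "\<And>a. a \<in> topspace A \<Longrightarrow> p (f a) = p (g a)"
  shows "continuous_map A T (\<lambda>a. translation (f a) (g a))"
proof (rule continuous_map_locally)
  fix a assume a: "a \<in> topspace A"
  have pf: "continuous_map A B (\<lambda>a. p (f a))"
    using continuous_map_compose[OF f continuous_proj] by (simp add: o_def)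
  then have "p (f a) \<in> topspace B" using continuous_map_funspace a by fastforce
  then obtain U \<kappa> where U: "openin B U" "p (f a) \<in> U"
    and \<kappa>: "continuous_map (subtopology E {e \<in> topspace E. p e \<in> U}) T \<kappa>"
    "\<And>e h. e \<in> topspace E \<Longrightarrow> p e \<in> U \<Longrightarrow> h \<in> carrier G \<Longrightarrow> \<kappa> (act e h) = \<kappa> e \<otimes> h"
    "\<And>e e'. e \<in> topspace E \<Longrightarrow> e' \<in> topspace E \<Longrightarrow> p e \<in> U \<Longrightarrow> p e = p e' \<Longrightarrow> \<kappa> e = \<kappa> e' \<Longrightarrow> e = e'"
    by (rule local_coordinate) blast
  define V where "V = {a \<in> topspace A. p (f a) \<in> U}"
  have memE: "f a \<in> topspace E" "g a \<in> topspace E" if "a \<in> topspace A" for a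
    using continuous_map_funspace[OF f] continuous_map_funspace[OF g] that by auto
  have pU: "p (f a) \<in> U" "p (g a) \<in> U" if "a \<in> V" for a
    using that eq[of a] by (simp_all add: V_def)
  have "continuous_map (subtopology A V) (subtopology E {e \<in> topspace E. p e \<in> U}) f"
    "continuous_map (subtopology A V) (subtopology E {e \<in> topspace E. p e \<in> U}) g"
    using f g memE pU by (auto simp: continuous_map_in_subtopology intro: continuous_map_from_subtopology)
  then have "continuous_map (subtopology A V) T (\<lambda>a. inv (\<kappa> (f a)) \<otimes> \<kappa> (g a))"
    using continuous_map_compose[OF _ \<kappa>(1)] by (intro continuous_map_mult continuous_map_inv) (simp_all add: o_def)
  then have "continuous_map (subtopology A V) T (\<lambda>a. translation (f a) (g a))"
  proof (rule continuous_map_eq)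
    fix x assume "x \<in> topspace (subtopology A V)"
    then have x: "x \<in> topspace A" "x \<in> V" by auto
    show "inv (\<kappa> (f x)) \<otimes> \<kappa> (g x) = translation (f x) (g x)"
      by (rule translation_eq(1)[OF \<kappa> memE[OF x(1)] pU(1)[OF x(2)] eq[OF x(1)], symmetric])
  qed
  moreover have "openin A V"
    unfolding V_def using openin_continuous_map_preimage[OF pf U(1)] .
  ultimately show "\<exists>U. openin A U \<and> a \<in> U \<and> continuous_map (subtopology A U) T (\<lambda>a. translation (f a) (g a))"
    using a U by (intro exI[of _ V]) (auto simp: V_def)
qed

end

section \<open>Successive right translations of a point\<close>

primrec iterated_action :: "('e \<Rightarrow> 'g \<Rightarrow> 'e) \<Rightarrow> 'e \<Rightarrow> (nat \<Rightarrow> 'g) \<Rightarrow> nat \<Rightarrow> 'e" where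
  "iterated_action act e u 0 = e"
| "iterated_action act e u (Suc n) = act (iterated_action act e u n) (u n)"

context principal_G_bundle
begin

lemma iterated_action_closed:
  assumes "e \<in> topspace E" "\<And>i. i < n \<Longrightarrow> u i \<in> carrier G"
  shows "iterated_action act e u n \<in> topspace E \<and> p (iterated_action act e u n) = p e"
  using assms(2) by (induction n) (auto simp: assms(1) act_closed proj_act)

lemma iterated_action_trivial:
  assumes "e \<in> topspace E" "\<And>i. i < n \<Longrightarrow> u i = \<one>"
  shows "iterated_action act e u n = e"
  using assms(2) by (induction n) (auto simp: assms(1) act_one)

text \<open>Used at a marked time, where a single tent function is nonzero: the factors before
  \<open>j\<close> fix \<open>e\<close>, and those after it fix \<open>act e g\<close>.\<close>

lemma iterated_action_single:
  assumes "e \<in> topspace E" "g \<in> carrier G" "j < n"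
    and "\<And>i. i < n \<Longrightarrow> u i = (if i = j then g else \<one>)"
  shows "iterated_action act e u n = act e g"
  using assms(3,4)
proof (induction n)
  case (Suc n)
  show ?case
  proof (cases "j = n")
    case True
    then have "iterated_action act e u n = e"
      using Suc.prems(2) by (intro iterated_action_trivial assms(1)) auto
    then show ?thesis using True Suc.prems(2)[of n] by simp
  next
    case False
    then have "iterated_action act e u n = act e g" using Suc.prems by (intro Suc.IH) auto
    then show ?thesis using False Suc.prems(2)[of n] assms(1,2) by (simp add: act_one act_closed)
  qed
qed simp

lemma continuous_map_iterated_action:
  assumes "continuous_map A E f" "\<And>i. i < n \<Longrightarrow> continuous_map A T (u i)"
  shows "continuous_map A E (\<lambda>a. iterated_action act (f a) (\<lambda>i. u i a) n)"
  using assms(2) by (induction n) (auto simp: assms(1) intro!: continuous_map_act)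

end

section \<open>The three inequalities\<close>

text \<open>For \<open>r = 1\<close> the divisor vanishes and the only marked time is
  \<open>0 / 0 = 0\<close>, which still lies in the interval.\<close>

lemma path_eval_point: "i < r \<Longrightarrow> real i / real (r - 1) \<in> {0..1}"
  by (auto simp: divide_le_eq_1 of_nat_diff)

lemma path_eval_eqD: "path_eval r \<gamma> = e \<Longrightarrow> i < r \<Longrightarrow> \<gamma> (real i / real (r - 1)) = e i"
  by (auto simp: path_eval_def)

lemma path_eval_eqI:
  assumes "e \<in> extensional {..<r}" "\<And>i. i < r \<Longrightarrow> \<gamma> (real i / real (r - 1)) = e i"
  shows "path_eval r \<gamma> = e"
  unfolding path_eval_def by (rule extensionalityI[of _ "{..<r}"]) (use assms in auto)

section \<open>Restriction to one fibre\<close>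

lemma dTC_le_dTC_parametrized:
  assumes pb: "principal_bundle G (mtopology_of mG) (mtopology_of mE) B p act"
    and "topspace B \<noteq> {}" and "r > 0"
  shows "dTC r mG \<le> dTC_parametrized r mE p"
proof -
  interpret principal_G_bundle G "mtopology_of mG" "mtopology_of mE" B p act
    using pb by (intro principal_G_bundle.intro top_group.intro top_group_axioms.intro principal_G_bundle_axioms.intro)
      (auto simp: principal_bundle_def topological_group_def)
  have carrier: "mspace mG = carrier G" using topspace_eq by simp
  obtain e0 where e0: "e0 \<in> mspace mE" using total_space_nonempty assms(2) by auto
  \<comment> \<open>The orbit map of \<open>e0\<close> identifies the group with one fibre; its
    inverse \<open>translation e0\<close> brings fibre paths back to the group.\<close>
  define f where "f g = (\<lambda>i\<in>{..<r}. act e0 (g i))" for g :: "nat \<Rightarrow> 'a"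
  define X where "X = subtopology (prod_topology (product_topology (\<lambda>_. mtopology_of mG) {..<r}) (mtopology_of (fibre_paths mE p)))
     {(g, \<gamma>). path_eval r \<gamma> = f g}"
  have X: "fst z \<in> {..<r} \<rightarrow>\<^sub>E carrier G" "snd z \<in> mspace (path_metric mE)"
    "t \<in> {0..1} \<Longrightarrow> snd z t \<in> mspace mE" "t \<in> {0..1} \<Longrightarrow> p (snd z t) = p e0"
    "path_eval r (snd z) = f (fst z)"
    if zX: "z \<in> topspace X" for z t
  proof -
    show z: "fst z \<in> {..<r} \<rightarrow>\<^sub>E carrier G" "snd z \<in> mspace (path_metric mE)" "path_eval r (snd z) = f (fst z)"
      using zX by (auto simp: X_def fibre_paths_def carrier)
    show "snd z t \<in> mspace mE" if "t \<in> {0..1}"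
      using z(2) that by (auto simp: mspace_path_metric continuous_map_def)
    have "snd z \<in> mspace (fibre_paths mE p)"
      using zX by (simp only: X_def topspace_subtopology topspace_prod_topology topspace_mtopology_of Int_iff mem_Times_iff)
    then obtain x where x: "\<forall>t\<in>{0..1}. p (snd z t) = x"
      unfolding fibre_paths_def mspace_submetric by blast
    \<comment> \<open>A path in \<open>fibre_paths\<close> projects to some constant. Time
      \<open>0\<close> is a marked time, and its prescribed value in the orbit of \<open>e0\<close>
      shows that the constant is \<open>p e0\<close>, so \<open>translation e0\<close> is meaningful
      along the whole path.\<close>
    have "snd z 0 = act e0 (fst z 0)"
      using path_eval_eqD[OF z(3) \<open>r > 0\<close>] \<open>r > 0\<close> by (simp add: f_def)
    then have "p (snd z 0) = p e0"
      using z(1) \<open>r > 0\<close> e0 by (auto simp: proj_act PiE_iff)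
    then show "p (snd z t) = p e0" if "t \<in> {0..1}" using x that by force
  qed
  have cont_path: "continuous_map (prod_topology X (top_of_set {0..1::real})) (mtopology_of (path_metric mE)) (\<lambda>w. snd (fst w))"
  proof -
    have "continuous_map X (mtopology_of (path_metric mE)) snd"
      unfolding X_def fibre_paths_def mtopology_of_submetric
      by (intro continuous_map_from_subtopology continuous_map_into_fulltopology[OF continuous_map_snd])
    from continuous_map_compose[OF continuous_map_fst this] show ?thesis by (simp add: o_def)
  qed
  show ?thesis
    unfolding dTC_def dTC_parametrized_def
  proof (rule dsecat_le[where f = f and F = "\<lambda>z. restrict (\<lambda>t. translation e0 (snd z t)) {0..1}"])
    show "continuous_map (product_topology (\<lambda>_. mtopology_of mG) {..<r}) (fibre_power r mE p) f"
      unfolding fibre_power_def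
    proof (rule continuous_map_into_subtopology)
      show "continuous_map (product_topology (\<lambda>_. mtopology_of mG) {..<r}) (product_topology (\<lambda>_. mtopology_of mE) {..<r}) f"
        using e0 by (auto simp: f_def continuous_map_componentwise
            intro!: continuous_map_act continuous_map_product_projection[of _ _ "\<lambda>_. mtopology_of mG"])
      show "f \<in> topspace (product_topology (\<lambda>_. mtopology_of mG) {..<r}) \<rightarrow> {e. \<forall>i<r. \<forall>j<r. p (e i) = p (e j)}"
        using e0 by (auto simp: f_def proj_act PiE_iff carrier)
    qed
    have "continuous_map (prod_topology X (top_of_set {0..1})) (mtopology_of mG) (\<lambda>w. translation e0 (snd (fst w) (snd w)))"
      by (intro continuous_map_translation continuous_map_path_apply[OF cont_path] continuous_map_snd) (use e0 X in auto)
    then have "continuous_map X (mtopology_of (path_metric mG)) (\<lambda>z. restrict (\<lambda>t. translation e0 (snd z t)) {0..1})"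
      by (rule continuous_map_path_metric)
    then show "continuous_map (subtopology (prod_topology (product_topology (\<lambda>_. mtopology_of mG) {..<r}) (mtopology_of (fibre_paths mE p)))
        {(g, \<gamma>). path_eval r \<gamma> = f g}) (mtopology_of (path_metric mG)) (\<lambda>z. restrict (\<lambda>t. translation e0 (snd z t)) {0..1})"
      by (simp add: X_def)
    fix g \<gamma> assume "g \<in> topspace (product_topology (\<lambda>_. mtopology_of mG) {..<r})"
      and \<gamma>: "path_eval r \<gamma> = f g"
    then have g: "g \<in> {..<r} \<rightarrow>\<^sub>E carrier G" by (simp add: carrier)
    show "path_eval r (restrict (\<lambda>t. translation e0 (snd (g, \<gamma>) t)) {0..1}) = g"
    proof (rule path_eval_eqI)
      fix i assume i: "i < r"
      have "\<gamma> (real i / real (r - 1)) = act e0 (g i)"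
        using path_eval_eqD[OF \<gamma> i] i by (simp add: f_def)
      then show "restrict (\<lambda>t. translation e0 (snd (g, \<gamma>) t)) {0..1} (real i / real (r - 1)) = g i"
        using path_eval_point[OF i] g i e0 by (simp only: restrict_apply if_True snd_conv) (auto simp: translation_act PiE_iff)
    qed (use g in \<open>auto simp: PiE_iff\<close>)
  qed
qed

section \<open>Paths in a power of the group from one path in the group\<close>

lemma dcat_power_le_dTC:
  assumes tg: "topological_group G (mtopology_of mG)"
    and "r \<ge> 2" and x0: "x0 \<in> mspace (power_metric (r - 1) mG)"
  shows "dcat (power_metric (r - 1) mG) x0 \<le> dTC r mG"
proof -
  interpret top_group G "mtopology_of mG"
    using tg by (intro top_group.intro top_group_axioms.intro) (auto simp: topological_group_def)
  have carrier: "mspace mG = carrier G" using topspace_eq by simp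
  have r: "0 < r - 1" "0 < r" using assms by auto
  have pow: "mtopology_of (power_metric (r - 1) mG) = product_topology (\<lambda>_. mtopology_of mG) {..<r - 1}"
    using r by (simp add: mtopology_of_power_metric)
  have x0: "x0 \<in> extensional {..<r - 1}" "\<And>j. j < r - 1 \<Longrightarrow> x0 j \<in> carrier G"
    using x0 by (auto simp: mspace_power_metric carrier PiE_iff)
  \<comment> \<open>The \<open>r - 1\<close> coordinates correspond to the marked points
    \<open>1\<close> to \<open>r - 1\<close>, hence the shift by \<open>Suc\<close>; marked point
    \<open>0\<close> is reserved for the unit.\<close>
  define f where "f g = (\<lambda>i\<in>{..<r}. case i of 0 \<Rightarrow> \<one>\<^bsub>G\<^esub> | Suc j \<Rightarrow> inv\<^bsub>G\<^esub> (x0 j) \<otimes>\<^bsub>G\<^esub> g j)" for g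
  \<comment> \<open>The paths for \<open>dcat\<close> end at the base point, so
    \<open>\<gamma>\<close> is run backwards. At \<open>t = 0\<close> coordinate \<open>j\<close>
    reads the marked value, whose factor \<open>inv (x0 j)\<close> cancels; at \<open>t = 1\<close>
    it reads the unit and leaves \<open>x0 j\<close>.\<close>
  define h where "h \<gamma> t = (\<lambda>j\<in>{..<r - 1}. x0 j \<otimes>\<^bsub>G\<^esub> \<gamma> ((1 - t) * (real (Suc j) / real (r - 1))))"
    for \<gamma> :: "real \<Rightarrow> 'a" and t
  define X where "X = subtopology (prod_topology (mtopology_of (power_metric (r - 1) mG)) (mtopology_of (path_metric mG)))
     {(g, \<gamma>). path_eval r \<gamma> = f g}"
  have unit: "(1 - t) * (real (Suc j) / real (r - 1)) \<in> {0..1}" if "t \<in> {0..1}" "j < r - 1" for t j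
  proof -
    have "real (Suc j) / real (r - 1) \<in> {0..1}" using that(2) by (intro path_eval_point) simp
    moreover have "(1 - t) * q \<in> {0..1}" if "q \<in> {0..1}" for q
      using that \<open>t \<in> {0..1}\<close> by (auto intro: mult_le_one)
    ultimately show ?thesis by blast
  qed
  have eval: "h \<gamma> 1 = x0" "g \<in> {..<r - 1} \<rightarrow>\<^sub>E carrier G \<Longrightarrow> h \<gamma> 0 = g" if \<gamma>: "path_eval r \<gamma> = f g" for g \<gamma>
  proof -
    have "\<gamma> 0 = \<one>\<^bsub>G\<^esub>" using path_eval_eqD[OF \<gamma> r(2)] r by (simp add: f_def)
    then show "h \<gamma> 1 = x0" using x0 by (intro extensionalityI[of _ "{..<r - 1}"]) (auto simp: h_def)
    assume g: "g \<in> {..<r - 1} \<rightarrow>\<^sub>E carrier G"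
    show "h \<gamma> 0 = g"
    proof (rule extensionalityI[of _ "{..<r - 1}"])
      fix j assume "j \<in> {..<r - 1}"
      then have j: "j < r - 1" "Suc j < r" by auto
      have "\<gamma> (real (Suc j) / real (r - 1)) = inv\<^bsub>G\<^esub> (x0 j) \<otimes>\<^bsub>G\<^esub> g j"
        using path_eval_eqD[OF \<gamma> j(2)] j by (simp add: f_def)
      then show "h \<gamma> 0 j = g j"
        using g j x0 by (simp add: h_def PiE_iff m_assoc[symmetric])
    qed (use g in \<open>auto simp: h_def PiE_iff\<close>)
  qed
  show ?thesis
    unfolding dcat_def dTC_def
  proof (rule dsecat_le[where f = f and F = "\<lambda>z. restrict (h (snd z)) {0..1}"])
    show "continuous_map (mtopology_of (power_metric (r - 1) mG)) (product_topology (\<lambda>_. mtopology_of mG) {..<r}) f"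
    proof -
      have "continuous_map (product_topology (\<lambda>_. mtopology_of mG) {..<r - 1}) (mtopology_of mG)
          (\<lambda>g. case i of 0 \<Rightarrow> \<one>\<^bsub>G\<^esub> | Suc j \<Rightarrow> inv\<^bsub>G\<^esub> (x0 j) \<otimes>\<^bsub>G\<^esub> g j)" if "i < r" for i
        using that x0(2) carrier
        by (cases i) (auto intro!: continuous_map_mult continuous_map_product_projection[of _ _ "\<lambda>_. mtopology_of mG"])
      then show ?thesis unfolding pow by (auto simp: f_def continuous_map_componentwise)
    qed
    have cont_path: "continuous_map (prod_topology X (top_of_set {0..1::real})) (mtopology_of (path_metric mG)) (\<lambda>w. snd (fst w))"
    proof -
      have "continuous_map X (mtopology_of (path_metric mG)) snd"
        unfolding X_def by (intro continuous_map_from_subtopology continuous_map_snd)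
      from continuous_map_compose[OF continuous_map_fst this] show ?thesis by (simp add: o_def)
    qed
    have "continuous_map (prod_topology X (top_of_set {0..1})) (mtopology_of (power_metric (r - 1) mG)) (\<lambda>w. h (snd (fst w)) (snd w))"
      unfolding pow h_def continuous_map_componentwise
    proof (intro conjI ballI)
      fix j assume "j \<in> {..<r - 1}"
      then have j: "j < r - 1" by simp
      have "continuous_map (prod_topology X (top_of_set {0..1})) (top_of_set {0..1})
          (\<lambda>w. (1 - snd w) * (real (Suc j) / real (r - 1)))"
        using unit j by (intro continuous_map_into_subtopology continuous_map_real_mult continuous_map_diff
            continuous_map_into_fulltopology[OF continuous_map_snd]) auto
      then have "continuous_map (prod_topology X (top_of_set {0..1})) (mtopology_of mG)
          (\<lambda>w. x0 j \<otimes>\<^bsub>G\<^esub> snd (fst w) ((1 - snd w) * (real (Suc j) / real (r - 1))))"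
        using x0(2)[OF j] carrier by (intro continuous_map_mult continuous_map_path_apply[OF cont_path]) auto
      then show "continuous_map (prod_topology X (top_of_set {0..1})) (mtopology_of mG)
         (\<lambda>w. (\<lambda>j\<in>{..<r - 1}. x0 j \<otimes>\<^bsub>G\<^esub> snd (fst w) ((1 - snd w) * (real (Suc j) / real (r - 1)))) j)"
        using j by simp
    qed auto
    then have "continuous_map X (mtopology_of (path_metric (power_metric (r - 1) mG))) (\<lambda>z. restrict (h (snd z)) {0..1})"
      by (rule continuous_map_path_metric)
    then show "continuous_map (subtopology (prod_topology (mtopology_of (power_metric (r - 1) mG)) (mtopology_of (path_metric mG)))
        {(g, \<gamma>). path_eval r \<gamma> = f g})
        (mtopology_of (submetric (path_metric (power_metric (r - 1) mG)) {\<phi>. \<phi> 1 = x0})) (\<lambda>z. restrict (h (snd z)) {0..1})"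
      unfolding mtopology_of_submetric X_def
      by (rule continuous_map_into_subtopology) (auto simp: eval(1))
    fix g \<gamma> assume "g \<in> topspace (mtopology_of (power_metric (r - 1) mG))" "path_eval r \<gamma> = f g"
    then show "restrict (h (snd (g, \<gamma>))) {0..1} 0 = g"
      using eval(2) by (simp add: mspace_power_metric carrier)
  qed
qed

section \<open>Fibre paths assembled from paths in the group\<close>

lemma dTC_parametrized_le_dcat_power:
  assumes pb: "principal_bundle G (mtopology_of mG) (mtopology_of mE) B p act"
    and "r \<ge> 2" and x0: "x0 \<in> mspace (power_metric (r - 1) mG)"
  shows "dTC_parametrized r mE p \<le> dcat (power_metric (r - 1) mG) x0"
proof -
  interpret principal_G_bundle G "mtopology_of mG" "mtopology_of mE" B p act
    using pb by (intro principal_G_bundle.intro top_group.intro top_group_axioms.intro principal_G_bundle_axioms.intro)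
      (auto simp: principal_bundle_def topological_group_def)
  have carrier: "mspace mG = carrier G" using topspace_eq by simp
  have r: "0 < r - 1" "0 < r" using assms by auto
  have pow: "mtopology_of (power_metric (r - 1) mG) = product_topology (\<lambda>_. mtopology_of mG) {..<r - 1}"
    using r by (simp add: mtopology_of_power_metric)
  have x0: "x0 j \<in> carrier G" if "j < r - 1" for j
    using x0 that by (auto simp: mspace_power_metric carrier PiE_iff)
  \<comment> \<open>Left translation by \<open>x0\<close> accommodates an arbitrary base point: a
    path from \<open>f e\<close> to \<open>x0\<close> becomes, after cancelling \<open>x0\<close>, a
    family of paths from the translations to the unit.\<close>
  define f where "f e = (\<lambda>j\<in>{..<r - 1}. x0 j \<otimes>\<^bsub>G\<^esub> translation (e 0) (e (Suc j)))" for e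
  \<comment> \<open>The tent peaks at the marked time with index \<open>Suc j\<close> and vanishes
    at all the others, because rescaling by \<open>r - 1\<close> puts the marked times at distance
    at least \<open>1\<close> from each other.\<close>
  define hat where "hat j t = max 0 (1 - \<bar>real (r - 1) * t - real (Suc j)\<bar>)" for j t
  \<comment> \<open>Since \<open>\<phi>\<close> ends at \<open>x0\<close>, it is read at
    \<open>1 - hat\<close>: height \<open>1\<close> gives its start \<open>f e\<close>, hence the
    full translation, and height \<open>0\<close> gives its end \<open>x0\<close>, hence the
    unit.\<close>
  define u where "u j \<phi> t = inv\<^bsub>G\<^esub> (x0 j) \<otimes>\<^bsub>G\<^esub> \<phi> (1 - hat j t) j" for j t and \<phi> :: "real \<Rightarrow> nat \<Rightarrow> 'a"
  define h where "h z t = iterated_action act (fst z (0::nat)) (\<lambda>j. u j (snd z) t) (r - 1)" for z t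
  define P where "P = submetric (path_metric (power_metric (r - 1) mG)) {\<phi>. \<phi> 1 = x0}"
  define X where "X = subtopology (prod_topology (fibre_power r mE p) (mtopology_of P)) {(e, \<phi>). \<phi> 0 = f e}"
  have hat: "1 - hat j t \<in> {0..1}" for j t by (auto simp: hat_def)
  have power: "e i \<in> mspace mE" "p (e i) = p (e 0)" if "e \<in> topspace (fibre_power r mE p)" "i < r" for e i
  proof -
    have e: "e \<in> topspace (product_topology (\<lambda>_. mtopology_of mE) {..<r}) \<inter>
        {e. \<forall>i<r. \<forall>j<r. p (e i) = p (e j)}"
      using that(1) by (simp only: fibre_power_def topspace_subtopology)
    show "e i \<in> mspace mE" using IntD1[OF e] that(2) by (auto simp: PiE_iff)
    show "p (e i) = p (e 0)" using IntD2[OF e] that(2) r(2) by blast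
  qed
  have u_closed: "u j \<phi> t \<in> carrier G" if "\<phi> \<in> mspace P" "j < r - 1" for j \<phi> t
  proof -
    have "\<phi> (1 - hat j t) \<in> mspace (power_metric (r - 1) mG)"
      using hat that(1) by (auto simp: P_def mspace_path_metric continuous_map_def)
    then have "\<phi> (1 - hat j t) j \<in> carrier G"
      using that(2) by (auto simp: mspace_power_metric carrier PiE_iff)
    then show ?thesis using x0[OF that(2)] by (simp add: u_def)
  qed
  have h_closed: "h (e, \<phi>) t \<in> mspace mE \<and> p (h (e, \<phi>) t) = p (e 0)"
    if "e \<in> topspace (fibre_power r mE p)" "\<phi> \<in> mspace P" for e \<phi> t
    using iterated_action_closed[of "e 0" "r - 1" "\<lambda>j. u j \<phi> t"] power(1)[OF that(1) r(2)] u_closed[OF that(2)]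
    by (simp add: h_def)
  have f_closed: "translation (e 0) (e i) \<in> carrier G" if "e \<in> topspace (fibre_power r mE p)" "i < r" for e i
    using translation_closed power[OF that] power[OF that(1) r(2)] by simp
  have eval: "h (e, \<phi>) (real i / real (r - 1)) = e i"
    if e: "e \<in> topspace (fibre_power r mE p)" and \<phi>: "\<phi> \<in> mspace P" "\<phi> 0 = f e" and i: "i < r" for e \<phi> i
  proof -
    have "real (r - 1) * (real i / real (r - 1)) = real i" using r by simp
    then have hat_i: "hat j (real i / real (r - 1)) = (if i = Suc j then 1 else 0)" for j
      by (cases "i < Suc j") (auto simp: hat_def simp del: of_nat_Suc of_nat_diff)
    have u_i: "u j \<phi> (real i / real (r - 1)) = (if i = Suc j then translation (e 0) (e i) else \<one>\<^bsub>G\<^esub>)" if "j < r - 1" for j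
    proof -
      have "\<phi> 1 = x0" using \<phi>(1) by (simp add: P_def)
      moreover have "u j \<phi> (real i / real (r - 1)) = inv\<^bsub>G\<^esub> (x0 j) \<otimes>\<^bsub>G\<^esub> \<phi> (1 - (if i = Suc j then 1 else 0)) j"
        by (simp only: u_def hat_i)
      ultimately show ?thesis
        using that x0[OF that] f_closed[OF e i]
        by (cases "i = Suc j") (simp_all add: \<phi>(2) f_def m_assoc[symmetric])
    qed
    show ?thesis
    proof (cases i)
      \<comment> \<open>No tent peaks at time \<open>0\<close>, so all factors are trivial and the
        path starts at \<open>e 0\<close>.\<close>
      case 0
      then show ?thesis
        using u_i power(1)[OF e r(2)] by (auto simp: h_def intro!: iterated_action_trivial)
    next
      case (Suc k)
      \<comment> \<open>Only factor \<open>k\<close> survives at marked point \<open>Suc k\<close>,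
        and it moves \<open>e 0\<close> to \<open>e i\<close> by definition of the
        translation.\<close>
      have "h (e, \<phi>) (real i / real (r - 1)) = act (e 0) (translation (e 0) (e i))"
        unfolding h_def fst_conv snd_conv using u_i power(1)[OF e r(2)] f_closed[OF e i] i Suc
        by (intro iterated_action_single[where j = k]) auto
      then show ?thesis using act_translation power[OF e i] power[OF e r(2)] by simp
    qed
  qed
  have proj: "continuous_map (fibre_power r mE p) (mtopology_of mE) (\<lambda>e. e i)" if "i < r" for i
    unfolding fibre_power_def using that
    by (intro continuous_map_from_subtopology continuous_map_product_projection[of _ _ "\<lambda>_. mtopology_of mE"]) auto
  have "dsecat (fibre_paths mE p) (path_eval r) (fibre_power r mE p)
      \<le> dsecat P (\<lambda>\<phi>. \<phi> 0) (mtopology_of (power_metric (r - 1) mG))"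
  proof (rule dsecat_le[where f = f and F = "\<lambda>z. restrict (h z) {0..1}"])
    have "continuous_map (fibre_power r mE p) (mtopology_of mG) (\<lambda>e. x0 j \<otimes>\<^bsub>G\<^esub> translation (e 0) (e (Suc j)))"
      if "j < r - 1" for j
    proof -
      have "p (e 0) = p (e (Suc j))" if "e \<in> topspace (fibre_power r mE p)" for e
        using power(2)[OF that, of "Suc j"] \<open>j < r - 1\<close> by simp
      then show ?thesis
        using that x0[OF that] carrier r by (intro continuous_map_mult continuous_map_translation proj) auto
    qed
    then show "continuous_map (fibre_power r mE p) (mtopology_of (power_metric (r - 1) mG)) f"
      unfolding pow by (auto simp: f_def continuous_map_componentwise)
    let ?Y = "prod_topology X (top_of_set {0..1::real})"
    have "continuous_map X (mtopology_of (path_metric (power_metric (r - 1) mG))) snd"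
      unfolding X_def P_def mtopology_of_submetric
      by (intro continuous_map_from_subtopology continuous_map_into_fulltopology[OF continuous_map_snd])
    from continuous_map_compose[OF continuous_map_fst this]
    have cont_path: "continuous_map ?Y (mtopology_of (path_metric (power_metric (r - 1) mG))) (\<lambda>w. snd (fst w))"
      by (simp add: o_def)
    have "continuous_map X (fibre_power r mE p) fst"
      unfolding X_def by (intro continuous_map_from_subtopology continuous_map_fst)
    from continuous_map_compose[OF continuous_map_compose[OF continuous_map_fst this] proj[OF r(2)]]
    have cont_e: "continuous_map ?Y (mtopology_of mE) (\<lambda>w. fst (fst w) 0)"
      by (simp add: o_def)
    have cont_u: "continuous_map ?Y (mtopology_of mG) (\<lambda>w. u j (snd (fst w)) (snd w))" if j: "j < r - 1" for j
    proof -
      have "continuous_map ?Y (top_of_set {0..1}) (\<lambda>w. 1 - hat j (snd w))"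
        using hat unfolding hat_def
        by (intro continuous_map_into_subtopology continuous_map_real_mult continuous_map_diff continuous_map_real_max
            continuous_map_real_abs continuous_map_into_fulltopology[OF continuous_map_snd]) auto
      from continuous_map_path_apply[OF cont_path this]
      have "continuous_map ?Y (mtopology_of mG) (\<lambda>w. snd (fst w) (1 - hat j (snd w)) j)"
        unfolding pow using j by (auto simp: continuous_map_componentwise)
      then show ?thesis
        unfolding u_def using x0[OF j] carrier by (intro continuous_map_mult) auto
    qed
    have "continuous_map ?Y (mtopology_of mE) (\<lambda>w. h (fst w) (snd w))"
      unfolding h_def by (intro continuous_map_iterated_action cont_e cont_u)
    then have "continuous_map X (mtopology_of (path_metric mE)) (\<lambda>z. restrict (h z) {0..1})"
      by (rule continuous_map_path_metric)
    moreover have "restrict (h z) {0..1} \<in> {\<gamma>. \<exists>x. \<forall>t\<in>{0..1}. p (\<gamma> t) = x}" if "z \<in> topspace X" for z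
      using h_closed[of "fst z" "snd z"] that by (auto simp: X_def)
    ultimately have "continuous_map X (mtopology_of (fibre_paths mE p)) (\<lambda>z. restrict (h z) {0..1})"
      unfolding fibre_paths_def mtopology_of_submetric by (intro continuous_map_into_subtopology) auto
    then show "continuous_map (subtopology (prod_topology (fibre_power r mE p) (mtopology_of P)) {(e, \<phi>). \<phi> 0 = f e})
      (mtopology_of (fibre_paths mE p)) (\<lambda>z. restrict (h z) {0..1})"
      by (simp add: X_def)
    fix e \<phi> assume e: "e \<in> topspace (fibre_power r mE p)" and \<phi>: "\<phi> \<in> mspace P" "\<phi> 0 = f e"
    show "path_eval r (restrict (h (e, \<phi>)) {0..1}) = e"
    proof (rule path_eval_eqI)
      show "e \<in> extensional {..<r}" using e by (auto simp: fibre_power_def PiE_iff)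
      show "restrict (h (e, \<phi>)) {0..1} (real i / real (r - 1)) = e i" if "i < r" for i
        using path_eval_point[OF that] eval[OF e \<phi> that] by (simp only: restrict_apply if_True)
    qed
  qed
  then show ?thesis by (simp add: dTC_parametrized_def dcat_def P_def)
qed

theorem proposition4p11:
  fixes G :: "('g, 'u) monoid_scheme"
    and mG :: "'g metric" and mE :: "'e metric" and B :: "'b topology"
    and p :: "'e \<Rightarrow> 'b" and act :: "'e \<Rightarrow> 'g \<Rightarrow> 'e"
    and r :: nat and x0 :: "nat \<Rightarrow> 'g"
  assumes "topological_group G (mtopology_of mG)"
    and "path_connected_space (mtopology_of mG)"
    and "principal_bundle G (mtopology_of mG) (mtopology_of mE) B p act"
    and "path_connected_space (mtopology_of mE)"
    and "path_connected_space B" and "topspace B \<noteq> {}"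
    and "r \<ge> 2"
    and "x0 \<in> mspace (power_metric (r - 1) mG)"
  shows "dTC_parametrized r mE p = dTC r mG \<and>
         dTC r mG = dcat (power_metric (r - 1) mG) x0"
proof -
  have "dTC r mG \<le> dTC_parametrized r mE p"
    using assms by (intro dTC_le_dTC_parametrized) auto
  moreover have "dTC_parametrized r mE p \<le> dcat (power_metric (r - 1) mG) x0"
    using assms by (intro dTC_parametrized_le_dcat_power) auto
  moreover have "dcat (power_metric (r - 1) mG) x0 \<le> dTC r mG"
    using assms by (intro dcat_power_le_dTC) auto
  ultimately show ?thesis by auto
qed

end
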